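(* Let $n\ge1$, let $D$ be an $n\times n$ matrix with nonnegative real entries, let $q>n$ be a prime power, $r=\lfloor(q-1)/2\rfloor$, and $\gamma=\frac{q}{3r}\left(\frac12-\frac rq\right)^2$. For any $\delta>0$, the PERM-WISH algorithm run on $D$ with parameters $q,r,\delta$ makes $\Theta(n\log\frac n\delta)$ calls to the MAX-oracle and, with probability at least $1-\delta$, outputs $\hat Z$ that is a $(q/r)^2=(4+O(1/n))$-approximation of $\mathrm{Perm}(D)$, i.e. $\mathrm{Perm}(D)/(q/r)^2\le\hat Z\le (q/r)^2\,\mathrm{Perm}(D)$.
   Context: $\mathrm{Perm}(D)=\sum_{\sigma\in S_n}\prod_{i=1}^nD_{i,\sigma(i)}$, where $S_n$ is the symmetric group; write $w(\sigma)=\prod_{i=1}^n D_{i,\sigma(i)}$. Fix an enumeration $\mathbb{F}_q=\{\alpha_0,\dots,\alpha_{q-1}\}$ with $\alpha_a<\alpha_b$ iff $a<b$ (an ordering only); for vectors, $u<v$ means coordinatewise $<$; $\mathbf 1$ is the all-ones vector. Identify each $\sigma\in S_n$ with the vector $(\alpha_{\sigma(1)-1},\dots,\alpha_{\sigma(n)-1})\in\mathbb{F}_q^n$. The MAX-oracle, given $A\in\mathbb{F}_q^{m\times n}$, $b\in\mathbb{F}_q^m$, returns exactly $\max\{w(\sigma):\sigma\in S_n,\ A\sigma+b<\alpha_r\cdot\mathbf 1\}$ (arithmetic in $\mathbb{F}_q$; max over the empty set is $0$). PERM-WISH: set $\ell=\lceil\frac1\gamma\ln\frac{2n}\delta\rceil$,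 $n'=\lceil n\log_{q/r}q\rceil$, $M_0=\max_{\sigma\in S_n}w(\sigma)$. For $i=1,\dots,n'$ and $k=1,\dots,\ell$, independently sample $A^i\in\mathbb{F}_q^{i\times n}$, $b^i\in\mathbb{F}_q^i$ with independent uniform entries and let $w_i^{(k)}$ be the oracle value for $(A^i,b^i)$; let $M_i$ be the median of $w_i^{(1)},\dots,w_i^{(\ell)}$. Output $\hat Z=M_0+\left(\frac qr-1\right)\sum_{i=0}^{n'-1}M_{i+1}\left(\frac qr\right)^i$.
   Formalization: The call count is not Θ(n log(n/δ)) uniformly in q (1/γ is of order q²): it is proved with constants depending on q, and uniformly with the extra factor log_{q/r}(q)/γ, both for n/δ ≥ c with any fixed c > 1; q = 2 (where r = 0 and q/r is undefined) is excluded. *)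

theory Defs
  imports
    "HOL-Probability.Probability"
    "HOL-Library.Landau_Symbols"
    "HOL-Number_Theory.Prime_Powers"
    "Jordan_Normal_Form.Matrix"
begin

no_notation vec_nth (infixl \<open>$\<close> 90)

text \<open>Matrices, vectors and permutations are indexed from \<open>0\<close>, so that \<open>S\<^sub>n\<close> is the set of
  permutations of \<open>{0..<n}\<close>.\<close>

definition perm_weight :: "'a::comm_semiring_1 mat \<Rightarrow> (nat \<Rightarrow> nat) \<Rightarrow> 'a" where
  "perm_weight D \<sigma> = (\<Prod>i\<in>{0..<dim_row D}. D $$ (i, \<sigma> i))"

definition permanent :: "'a::comm_semiring_1 mat \<Rightarrow> 'a" where
  "permanent D = (\<Sum>\<sigma> | \<sigma> permutes {0..<dim_row D}. perm_weight D \<sigma>)"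

text \<open>Below, \<open>\<alpha>\<close> enumerates a finite field as \<open>\<alpha> 0, \<dots>, \<alpha> (q - 1)\<close>. The order it induces is
  unrelated to the field operations.\<close>

definition enum_less :: "(nat \<Rightarrow> 'f::finite) \<Rightarrow> 'f \<Rightarrow> 'f \<Rightarrow> bool" where
  "enum_less \<alpha> x y \<longleftrightarrow> (\<exists>a b. a < b \<and> b < CARD('f) \<and> x = \<alpha> a \<and> y = \<alpha> b)"

definition enum_vec_less :: "(nat \<Rightarrow> 'f::finite) \<Rightarrow> 'f Matrix.vec \<Rightarrow> 'f Matrix.vec \<Rightarrow> bool" where
  "enum_vec_less \<alpha> u v \<longleftrightarrow> dim_vec u = dim_vec v \<and> (\<forall>j<dim_vec u. enum_less \<alpha> (u $ j) (v $ j))"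

text \<open>With 0-based permutations the \<open>i\<close>-th coordinate is \<open>\<alpha> (\<sigma> i)\<close>, not \<open>\<alpha> (\<sigma> i - 1)\<close>.\<close>

definition perm_vec :: "(nat \<Rightarrow> 'f) \<Rightarrow> nat \<Rightarrow> (nat \<Rightarrow> nat) \<Rightarrow> 'f Matrix.vec" where
  "perm_vec \<alpha> n \<sigma> = Matrix.vec n (\<lambda>i. \<alpha> (\<sigma> i))"

definition max_oracle ::
  "(nat \<Rightarrow> 'f::{field,finite}) \<Rightarrow> nat \<Rightarrow> real mat \<Rightarrow> 'f mat \<Rightarrow> 'f Matrix.vec \<Rightarrow> real" where
  "max_oracle \<alpha> r D A b =
    (let n = dim_row D;
         W = {perm_weight D \<sigma> | \<sigma>. \<sigma> permutes {0..<n} \<and>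
               enum_vec_less \<alpha> (A *\<^sub>v perm_vec \<alpha> n \<sigma> + b)
                 (\<alpha> r \<cdot>\<^sub>v Matrix.vec (dim_row A) (\<lambda>_. 1))}
     in if W = {} then 0 else Max W)"

text \<open>For an even number of values, the mean of the two middle ones.\<close>

definition median :: "real list \<Rightarrow> real" where
  "median xs =
    (let s = sort xs; l = length xs
     in if odd l then s ! (l div 2) else (s ! (l div 2 - 1) + s ! (l div 2)) / 2)"

definition wish_r :: "nat \<Rightarrow> nat" where
  "wish_r q = (q - 1) div 2"

definition wish_gamma :: "nat \<Rightarrow> nat \<Rightarrow> real" where
  "wish_gamma q r = real q / (3 * real r) * (1 / 2 - real r / real q)\<^sup>2"

definition wish_reps :: "nat \<Rightarrow> nat \<Rightarrow> nat \<Rightarrow> real \<Rightarrow> nat" where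
  "wish_reps n q r \<delta> = nat \<lceil>1 / wish_gamma q r * ln (2 * real n / \<delta>)\<rceil>"

definition wish_levels :: "nat \<Rightarrow> nat \<Rightarrow> nat \<Rightarrow> nat" where
  "wish_levels n q r = nat \<lceil>real n * log (real q / real r) (real q)\<rceil>"

text \<open>The algorithm makes one oracle call for each pair \<open>(i, k)\<close> of a level and a repetition.\<close>

definition wish_queries :: "nat \<Rightarrow> nat \<Rightarrow> nat \<Rightarrow> real \<Rightarrow> (nat \<times> nat) set" where
  "wish_queries n q r \<delta> = {1..wish_levels n q r} \<times> {1..wish_reps n q r \<delta>}"

definition wish_calls :: "nat \<Rightarrow> nat \<Rightarrow> nat \<Rightarrow> real \<Rightarrow> nat" where
  "wish_calls n q r \<delta> = card (wish_queries n q r \<delta>)"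

definition uniform_mat :: "nat \<Rightarrow> nat \<Rightarrow> 'f::{field,finite} mat pmf" where
  "uniform_mat m n =
    map_pmf (Matrix.mat m n) (Pi_pmf ({0..<m} \<times> {0..<n}) 0 (\<lambda>_. pmf_of_set UNIV))"

definition uniform_vec :: "nat \<Rightarrow> 'f::{field,finite} Matrix.vec pmf" where
  "uniform_vec m = map_pmf (Matrix.vec m) (Pi_pmf {0..<m} 0 (\<lambda>_. pmf_of_set UNIV))"

definition wish_samples ::
  "nat \<Rightarrow> nat \<Rightarrow> nat \<Rightarrow> real \<Rightarrow> (nat \<times> nat \<Rightarrow> 'f::{field,finite} mat \<times> 'f Matrix.vec) pmf" where
  "wish_samples n q r \<delta> =
    Pi_pmf (wish_queries n q r \<delta>) undefined (\<lambda>(i, k). pair_pmf (uniform_mat i n) (uniform_vec i))"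

definition wish_median ::
  "(nat \<Rightarrow> 'f::{field,finite}) \<Rightarrow> real mat \<Rightarrow> nat \<Rightarrow> nat \<Rightarrow> real \<Rightarrow>
    (nat \<times> nat \<Rightarrow> 'f mat \<times> 'f Matrix.vec) \<Rightarrow> nat \<Rightarrow> real" where
  "wish_median \<alpha> D q r \<delta> S i =
    median (map (\<lambda>k. max_oracle \<alpha> r D (fst (S (i, k))) (snd (S (i, k))))
      [1..<Suc (wish_reps (dim_row D) q r \<delta>)])"

definition wish_estimate ::
  "(nat \<Rightarrow> 'f::{field,finite}) \<Rightarrow> real mat \<Rightarrow> nat \<Rightarrow> nat \<Rightarrow> real \<Rightarrow>
    (nat \<times> nat \<Rightarrow> 'f mat \<times> 'f Matrix.vec) \<Rightarrow> real" where
  "wish_estimate \<alpha> D q r \<delta> S =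
    Max (perm_weight D ` {\<sigma>. \<sigma> permutes {0..<dim_row D}}) +
    (real q / real r - 1) *
      (\<Sum>i<wish_levels (dim_row D) q r. wish_median \<alpha> D q r \<delta> S (i + 1) * (real q / real r) ^ i)"

definition perm_wish ::
  "(nat \<Rightarrow> 'f::{field,finite}) \<Rightarrow> real mat \<Rightarrow> nat \<Rightarrow> nat \<Rightarrow> real \<Rightarrow> real pmf" where
  "perm_wish \<alpha> D q r \<delta> =
    map_pmf (wish_estimate \<alpha> D q r \<delta>) (wish_samples (dim_row D) q r \<delta>)"

end

theory Submission
  imports Defs
begin

text \<open>
  Let \<open>Q = q / r\<close> and let \<open>s 0 \<ge> s 1 \<ge> \<dots>\<close> be the \<open>n!\<close> permutation weights in decreasing order, continued
  by \<open>0\<close>. The permanent is the integral of the step function \<open>x \<mapsto> s \<lfloor>x\<rfloor>\<close>, and the estimate is a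
  quadrature of it on a geometric grid of ratio \<open>Q\<close>: it is off by at most a factor \<open>Q\<^sup>2\<close> as soon as
  \<open>s \<lfloor>Q ^ (i + 1)\<rfloor> \<le> M i \<le> s \<lfloor>Q ^ (i - 2)\<rfloor>\<close> for all levels \<open>i\<close>.

  The events that a permutation survives \<open>i\<close> random constraints have probability \<open>Q ^ (-i)\<close> and are
  pairwise independent. A union bound shows that one oracle value violates the upper inequality with
  probability at most \<open>Q ^ (-2)\<close>, and the second moment method that it violates the lower one with
  probability at most \<open>1 / (1 + Q)\<close>. By Hoeffding's inequality a median fails with probability at most
  \<open>(\<delta> / (2 n)) ^ e\<close>, where \<open>e \<ge> max 2 (q / 2)\<close>. There are \<open>n log\<^sub>Q q\<close> rather than \<open>n\<close> levels, so \<open>e = 1\<close>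
  would not be enough for the union bound over the levels, but this larger exponent is.
\<close>

section \<open>Second moment method and majority votes\<close>

text \<open>With \<open>X\<close> the number of events that occur, the indicator of
  \<open>X = 0\<close> is at most \<open>(1 - u * X)\<^sup>2\<close>, and pairwise independence
  controls the second moment of \<open>X\<close>. Chebyshev's inequality would give only
  \<open>1 / \<mu>\<close>; the extra 1 keeps the later failure probability
  \<open>1 / (1 + q / r)\<close> below 1/3, whereas \<open>r / q\<close> may be close to
  1/2.\<close>

lemma prob_none_pairwise_indep:
  fixes p :: "'a pmf" and E :: "'b \<Rightarrow> 'a set" and \<rho> :: real
  assumes "finite T"
    and prob: "\<And>s. s \<in> T \<Longrightarrow> measure_pmf.prob p (E s) = \<rho>"
    and pair: "\<And>s t. s \<in> T \<Longrightarrow> t \<in> T \<Longrightarrow> s \<noteq> t \<Longrightarrow> measure_pmf.prob p (E s \<inter> E t) = \<rho>\<^sup>2"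
  shows "measure_pmf.prob p {x. \<forall>s\<in>T. x \<notin> E s} \<le> 1 / (1 + real (card T) * \<rho>)"
proof (cases "T = {}")
  case False
  define \<mu> where "\<mu> = real (card T) * \<rho>"
  \<comment> \<open>This \<open>u\<close> minimises
    \<open>1 - 2 * u * \<mu> + u\<^sup>2 * (\<mu> + \<mu>\<^sup>2)\<close>, and the minimum is again
    \<open>u\<close>.\<close>
  define u where "u = 1 / (1 + \<mu>)"
  define X where "X x = (\<Sum>s\<in>T. indicat_real (E s) x)" for x
  have \<rho>: "\<rho> \<ge> 0"
    using False prob measure_nonneg by (metis all_not_in_conv)
  have \<mu>: "\<mu> \<ge> 0"
    unfolding \<mu>_def using \<rho> by simp
  have int: "integrable (measure_pmf p) (indicat_real A)" for A
    by (rule measure_pmf.integrable_const_bound[where B = 1]) (auto simp: indicator_def)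
  have EX: "measure_pmf.expectation p X = \<mu>"
    unfolding X_def \<mu>_def using prob by (subst Bochner_Integration.integral_sum) (auto intro: int)
  have sq: "(X x)\<^sup>2 = (\<Sum>s\<in>T. \<Sum>t\<in>T. indicat_real (E s \<inter> E t) x)" for x
    unfolding X_def power2_eq_square sum_product by (simp add: indicator_inter_arith)
  have intX2: "integrable (measure_pmf p) (\<lambda>x. (X x)\<^sup>2)"
    unfolding sq by (intro Bochner_Integration.integrable_sum int)
  have intX: "integrable (measure_pmf p) X"
    unfolding X_def by (intro Bochner_Integration.integrable_sum int)
  have "measure_pmf.expectation p (\<lambda>x. (X x)\<^sup>2) =
      (\<Sum>s\<in>T. \<Sum>t\<in>T. measure_pmf.prob p (E s \<inter> E t))"
    unfolding sq
    by (subst Bochner_Integration.integral_sum, intro Bochner_Integration.integrable_sum int,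
        intro sum.cong refl, subst Bochner_Integration.integral_sum) (auto intro: int)
  \<comment> \<open>Diagonal terms equal \<open>\<rho>\<close> but are charged
    \<open>\<rho> + \<rho>\<^sup>2\<close>, so that the double sum has a closed form.\<close>
  also have "\<dots> \<le> (\<Sum>s\<in>T. \<Sum>t\<in>T. (if t = s then \<rho> else 0) + \<rho>\<^sup>2)"
    using prob pair by (intro sum_mono) auto
  also have "\<dots> = \<mu> + \<mu>\<^sup>2"
    using \<open>finite T\<close> by (simp add: sum.distrib \<mu>_def power2_eq_square algebra_simps)
  finally have EX2: "measure_pmf.expectation p (\<lambda>x. (X x)\<^sup>2) \<le> \<mu> + \<mu>\<^sup>2" .
  have "measure_pmf.prob p {x. \<forall>s\<in>T. x \<notin> E s} =
      measure_pmf.expectation p (indicator {x. \<forall>s\<in>T. x \<notin> E s})"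
    by simp
  also have "\<dots> \<le> measure_pmf.expectation p (\<lambda>x. 1 - 2 * u * X x + u\<^sup>2 * (X x)\<^sup>2)"
  proof (intro integral_mono int)
    show "integrable (measure_pmf p) (\<lambda>x. 1 - 2 * u * X x + u\<^sup>2 * (X x)\<^sup>2)"
      using intX intX2 by auto
    fix x
    have "0 \<le> (1 - u * X x)\<^sup>2"
      by simp
    moreover have "X x = 0" if "\<forall>s\<in>T. x \<notin> E s"
      using that unfolding X_def by (auto intro: sum.neutral)
    ultimately show "indicat_real {x. \<forall>s\<in>T. x \<notin> E s} x \<le> 1 - 2 * u * X x + u\<^sup>2 * (X x)\<^sup>2"
      by (auto simp: indicator_def power2_eq_square algebra_simps)
  qed
  also have "\<dots> = 1 - 2 * u * \<mu> + u\<^sup>2 * measure_pmf.expectation p (\<lambda>x. (X x)\<^sup>2)"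
    using intX intX2 EX by simp
  also have "\<dots> \<le> 1 - 2 * u * \<mu> + u\<^sup>2 * (\<mu> + \<mu>\<^sup>2)"
    using EX2 by (simp add: mult_left_mono)
  also have "\<dots> = u"
  proof -
    have "u * (1 + \<mu>) = 1"
      using \<mu> unfolding u_def by simp
    moreover have "u\<^sup>2 * (\<mu> + \<mu>\<^sup>2) = u * \<mu> * (u * (1 + \<mu>))"
      by (simp add: power2_eq_square algebra_simps)
    ultimately show ?thesis
      by (simp add: algebra_simps)
  qed
  finally show ?thesis
    unfolding u_def \<mu>_def .
qed simp

text \<open>Hoeffding's inequality for the indicators of \<open>S j \<in> B\<close>: their expected
  sum is at most \<open>\<rho> * card J\<close>, so reaching half of \<open>J\<close> is a deviation
  of at least \<open>(1 / 2 - \<rho>) * card J\<close>. Later \<open>J\<close> consists of the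
  repetitions of one level.\<close>

lemma prob_Pi_pmf_half_of_rare_le:
  fixes p :: "'i \<Rightarrow> 'a pmf"
  assumes "finite I" "J \<subseteq> I" "\<rho> \<le> 1 / 2"
    and rare: "\<And>j. j \<in> J \<Longrightarrow> measure_pmf.prob (p j) B \<le> \<rho>"
  shows "measure_pmf.prob (Pi_pmf I d p) {S. real (card J) / 2 \<le> real (card {j\<in>J. S j \<in> B})}
    \<le> exp (- (2 * (1 / 2 - \<rho>)\<^sup>2 * real (card J)))"
proof (cases "J = {}")
  case False
  have fJ: "finite J"
    using assms finite_subset by blast
  define P where "P = Pi_pmf I d p"
  define X where "X j S = indicat_real B (S j)" for j and S :: "'i \<Rightarrow> 'a"
  define \<mu> where "\<mu> = (\<Sum>j\<in>J. measure_pmf.expectation P (X j))"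
  define c where "c = real (card J)"
  have c: "c > 0"
    unfolding c_def using False fJ by (simp add: card_gt_0_iff)
  have "prob_space.indep_vars (measure_pmf P) (\<lambda>_. count_space UNIV) (\<lambda>x f. f x) J"
    unfolding P_def by (rule prob_space.indep_vars_subset[OF measure_pmf.prob_space_axioms
          indep_vars_Pi_pmf[OF assms(1)] assms(2)])
  then have indep: "prob_space.indep_vars (measure_pmf P) (\<lambda>_. borel) X J"
    unfolding X_def 
    by (rule prob_space.indep_vars_compose2[OF measure_pmf.prob_space_axioms]) auto
  interpret H: Hoeffding_ineq "measure_pmf P" J X "\<lambda>_. 0" "\<lambda>_. 1" \<mu>
    by unfold_locales (use fJ indep in \<open>auto simp: X_def \<mu>_def\<close>)
  have EX: "measure_pmf.expectation P (X j) \<le> \<rho>" if "j \<in> J" for j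
  proof -
    have "X j = indicat_real ((\<lambda>f. f j) -` B)"
      by (auto simp: X_def indicator_def)
    then have "measure_pmf.expectation P (X j) = measure_pmf.prob (map_pmf (\<lambda>f. f j) P) B"
      by simp
    also have "\<dots> = measure_pmf.prob (p j) B"
      unfolding P_def using that assms by (subst Pi_pmf_component) auto
    finally show ?thesis
      using rare[OF that] by simp
  qed
  have \<mu>: "\<mu> \<le> \<rho> * c"
    unfolding \<mu>_def c_def using sum_mono[OF EX] by (simp add: mult.commute)
  \<comment> \<open>Measured from the true mean, so that \<open>\<mu> + t\<close> is exactly
    \<open>c / 2\<close>.\<close>
  define t where "t = c / 2 - \<mu>"
  have t: "t \<ge> (1 / 2 - \<rho>) * c"
    unfolding t_def using \<mu> by (simp add: algebra_simps)
  moreover have "(1 / 2 - \<rho>) * c \<ge> 0"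
    using assms c by simp
  ultimately have t2: "((1 / 2 - \<rho>) * c)\<^sup>2 \<le> t\<^sup>2" and t0: "t \<ge> 0"
    by (auto intro: power_mono)
  have sumX: "(\<Sum>j\<in>J. X j S) = real (card {j\<in>J. S j \<in> B})" for S
    using fJ by (simp add: X_def indicator_def sum.If_cases Int_def)
  have "measure_pmf.prob P {S. c / 2 \<le> real (card {j\<in>J. S j \<in> B})} =
      measure_pmf.prob P {S \<in> space (measure_pmf P). (\<Sum>j\<in>J. X j S) \<ge> \<mu> + t}"
    unfolding t_def by (simp add: sumX)
  also have "\<dots> \<le> exp (- 2 * t\<^sup>2 / c)"
    using H.Hoeffding_ineq_ge[OF t0] c unfolding c_def by simp
  also have "\<dots> \<le> exp (- (2 * (1 / 2 - \<rho>)\<^sup>2 * c))"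
    using t2 c by (simp add: field_simps power2_eq_square)
  finally show ?thesis
    unfolding P_def c_def .
qed simp

section \<open>Quadrature on a geometric grid\<close>

text \<open>For \<open>x \<ge> 0\<close>, the integral over [0, x] of the function with value
  \<open>s k\<close> on [k, k + 1), cut off at \<open>N\<close>: the clamp is the length of the part
  of [k, k + 1] inside [0, x].\<close>

definition step_integral :: "(nat \<Rightarrow> real) \<Rightarrow> nat \<Rightarrow> real \<Rightarrow> real" where
  "step_integral s N x = (\<Sum>k<N. s k * max 0 (min 1 (x - real k)))"

lemma sum_unit_clamps: "x \<ge> 0 \<Longrightarrow> (\<Sum>k<N. max 0 (min 1 (x - real k))) = min (real N) x"
  by (induction N) (auto simp: min_def max_def)

context
  fixes s :: "nat \<Rightarrow> real" and N :: nat
  assumes anti: "antimono s" and zero: "\<And>k. k \<ge> N \<Longrightarrow> s k = 0"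
begin

lemma antimono_eventually_zero_nonneg: "s k \<ge> 0"
proof -
  have "s (max k N) \<le> s k"
    using anti by (auto simp: antimono_def)
  then show ?thesis
    using zero[of "max k N"] by simp
qed

text \<open>\<open>c k y - c k x\<close> is the length of [k, k + 1] inside [x, y]. It vanishes for
  \<open>k > y\<close>, and the other \<open>s k\<close> are at least the value at the right end.
  For \<open>y\<close> beyond \<open>N\<close> the lengths need not add up to \<open>y - x\<close>,
  but then the right-end value is 0.\<close>

lemma step_integral_diff_ge:
  assumes "0 \<le> x" "x \<le> y"
  shows "(y - x) * s (nat \<lfloor>y\<rfloor>) \<le> step_integral s N y - step_integral s N x"
proof -
  define c where "c k z = max 0 (min 1 (z - real k))" for k and z :: real
  have c: "c k x \<le> c k y" for k
    using assms by (auto simp: c_def)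
  have term_ge: "s (nat \<lfloor>y\<rfloor>) * (c k y - c k x) \<le> s k * (c k y - c k x)" for k
  proof (cases "real k \<le> y")
    case True
    then have "k \<le> nat \<lfloor>y\<rfloor>"
      by (simp add: le_nat_floor)
    then have "s (nat \<lfloor>y\<rfloor>) \<le> s k"
      using anti by (auto simp: antimono_def)
    then show ?thesis
      using c by (intro mult_right_mono) auto
  next
    case False
    then have "c k y = 0" "c k x = 0"
      using assms by (auto simp: c_def)
    then show ?thesis by simp
  qed
  have "(y - x) * s (nat \<lfloor>y\<rfloor>) \<le> s (nat \<lfloor>y\<rfloor>) * (min N y - min N x)"
  proof (cases "y \<le> N")
    case False
    then have "N \<le> nat \<lfloor>y\<rfloor>"
      by (simp add: le_nat_floor)
    then show ?thesis
      by (simp add: zero)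
  qed (use assms in auto)
  also have "\<dots> = (\<Sum>k<N. s (nat \<lfloor>y\<rfloor>) * (c k y - c k x))"
    using assms sum_unit_clamps[of x N] sum_unit_clamps[of y N]
    by (simp add: c_def sum_subtractf flip: sum_distrib_left)
  also have "\<dots> \<le> (\<Sum>k<N. s k * (c k y - c k x))"
    by (intro sum_mono term_ge)
  also have "\<dots> = step_integral s N y - step_integral s N x"
    by (simp add: step_integral_def c_def algebra_simps sum_subtractf)
  finally show ?thesis .
qed

text \<open>Mirror image: pieces that end by \<open>x\<close> cancel, and the others have
  \<open>s k\<close> at most the value at the left end. Length lost beyond \<open>N\<close> only
  lowers the left-hand side.\<close>

lemma step_integral_diff_le:
  assumes "0 \<le> x" "x \<le> y"
  shows "step_integral s N y - step_integral s N x \<le> (y - x) * s (nat \<lfloor>x\<rfloor>)"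
proof -
  define c where "c k z = max 0 (min 1 (z - real k))" for k and z :: real
  have c: "c k x \<le> c k y" for k
    using assms by (auto simp: c_def)
  have term_le: "s k * (c k y - c k x) \<le> s (nat \<lfloor>x\<rfloor>) * (c k y - c k x)" for k
  proof (cases "real k + 1 \<le> x")
    case True
    then have "c k y = 1" "c k x = 1"
      using assms by (auto simp: c_def)
    then show ?thesis by simp
  next
    case False
    then have "nat \<lfloor>x\<rfloor> \<le> k"
      using assms by linarith
    then have "s k \<le> s (nat \<lfloor>x\<rfloor>)"
      using anti by (auto simp: antimono_def)
    then show ?thesis
      using c by (intro mult_right_mono) auto
  qed
  have "step_integral s N y - step_integral s N x = (\<Sum>k<N. s k * (c k y - c k x))"
    by (simp add: step_integral_def c_def algebra_simps sum_subtractf)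
  also have "\<dots> \<le> (\<Sum>k<N. s (nat \<lfloor>x\<rfloor>) * (c k y - c k x))"
    by (intro sum_mono term_le)
  also have "\<dots> = s (nat \<lfloor>x\<rfloor>) * (min N y - min N x)"
    using assms sum_unit_clamps[of x N] sum_unit_clamps[of y N]
    by (simp add: c_def sum_subtractf flip: sum_distrib_left)
  also have "\<dots> \<le> s (nat \<lfloor>x\<rfloor>) * (y - x)"
    using assms antimono_eventually_zero_nonneg by (intro mult_left_mono) auto
  finally show ?thesis by (simp add: mult.commute)
qed

lemma step_integral_le_sum: "step_integral s N x \<le> (\<Sum>k<N. s k)"
  unfolding step_integral_def
  using antimono_eventually_zero_nonneg by (intro sum_mono mult_left_le) auto

lemma step_integral_eq_sum: "x \<ge> real N \<Longrightarrow> step_integral s N x = (\<Sum>k<N. s k)"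
  unfolding step_integral_def by (intro sum.cong) auto

lemma step_integral_0: "step_integral s N 0 = 0"
  unfolding step_integral_def by (intro sum.neutral) auto

lemma step_integral_le_1:
  assumes "N \<ge> 1" "0 \<le> x" "x \<le> 1"
  shows "step_integral s N x = x * s 0"
proof -
  have "step_integral s N x = (\<Sum>k\<in>{0}. s k * max 0 (min 1 (x - real k)))"
    unfolding step_integral_def using assms by (intro sum.mono_neutral_right) auto
  then show ?thesis
    using assms by simp
qed

text \<open>The piece from \<open>Q ^ (l - 2)\<close> to \<open>Q ^ (l - 1)\<close> has length
  \<open>(Q - 1) * Q ^ l / Q\<^sup>2\<close>. As \<open>M l\<close> is at most the integrand at its
  right end, \<open>Q\<^sup>2\<close> times the integral over this piece pays for summand
  \<open>l\<close>.\<close>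

lemma geometric_quadrature_le:
  fixes Q :: real
  assumes "N \<ge> 1" "Q \<ge> 1"
    and M: "\<And>i. i < L \<Longrightarrow> M i \<le> s (nat \<lfloor>Q ^ i / Q\<rfloor>)"
  shows "s 0 + (Q - 1) * (\<Sum>i<L. M i * Q ^ i) \<le> Q\<^sup>2 * (\<Sum>k<N. s k)"
proof -
  \<comment> \<open>The quotient \<open>Q ^ l / Q\<^sup>2\<close> plays the role of
    \<open>Q ^ (l - 2)\<close>, also for \<open>l < 2\<close>.\<close>
  have "s 0 + (Q - 1) * (\<Sum>i<l. M i * Q ^ i) \<le> Q\<^sup>2 * step_integral s N (Q ^ l / Q\<^sup>2)"
    if "l \<le> L" for l
    using that
  proof (induction l)
    case 0
    \<comment> \<open>The integrand is constantly \<open>s 0\<close> on the first piece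
      [0, 1 / \<open>Q\<^sup>2\<close>], which pays for the summand \<open>s 0\<close>.\<close>
    have "1 / Q\<^sup>2 \<le> 1"
      using \<open>Q \<ge> 1\<close> by simp
    then have "step_integral s N (1 / Q\<^sup>2) = 1 / Q\<^sup>2 * s 0"
      using assms by (intro step_integral_le_1) auto
    then show ?case
      using \<open>Q \<ge> 1\<close> by simp
  next
    case (Suc l)
    define x y where "x = Q ^ l / Q\<^sup>2" and "y = Q ^ l / Q"
    have xy: "0 \<le> x" "x \<le> y" "Q\<^sup>2 * (y - x) = (Q - 1) * Q ^ l" "Q ^ Suc l / Q\<^sup>2 = y"
      using \<open>Q \<ge> 1\<close> by (auto simp: x_def y_def field_simps power2_eq_square)
    have "(Q - 1) * (M l * Q ^ l) = (Q - 1) * Q ^ l * M l"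
      by simp
    also have "\<dots> \<le> (Q - 1) * Q ^ l * s (nat \<lfloor>y\<rfloor>)"
      using M[of l] Suc.prems \<open>Q \<ge> 1\<close> by (intro mult_left_mono) (auto simp: y_def)
    also have "\<dots> = Q\<^sup>2 * ((y - x) * s (nat \<lfloor>y\<rfloor>))"
      by (simp flip: xy(3))
    also have "\<dots> \<le> Q\<^sup>2 * (step_integral s N y - step_integral s N x)"
      using step_integral_diff_ge[OF xy(1,2)] by (intro mult_left_mono) auto
    finally have "(Q - 1) * (M l * Q ^ l) \<le>
      Q\<^sup>2 * step_integral s N y - Q\<^sup>2 * step_integral s N x"
      by (simp add: right_diff_distrib)
    then show ?case
      using Suc unfolding xy(4) by (simp add: x_def distrib_left)
  qed
  from this[OF order_refl] show ?thesis
    using mult_left_mono[OF step_integral_le_sum, of "Q\<^sup>2" "Q ^ L / Q\<^sup>2"] by simp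
qed

text \<open>Now the grid is shifted upwards: the piece from \<open>Q ^ (l + 2)\<close> to
  \<open>Q ^ (l + 3)\<close> has length \<open>Q\<^sup>2\<close> times the weight of
  \<open>M l\<close>, which is at least the integrand at its left end. The start
  [0, \<open>Q\<^sup>2\<close>] is paid by \<open>Q\<^sup>2 * s 0\<close>, and
  \<open>N \<le> Q ^ (L + 2)\<close> lets the grid cover the whole sum.\<close>

lemma geometric_quadrature_ge:
  fixes Q :: real
  assumes "Q \<ge> 1" "real N \<le> Q ^ (L + 2)"
    and M: "\<And>i. i < L \<Longrightarrow> s (nat \<lfloor>Q ^ (i + 2)\<rfloor>) \<le> M i"
  shows "(\<Sum>k<N. s k) \<le> Q\<^sup>2 * (s 0 + (Q - 1) * (\<Sum>i<L. M i * Q ^ i))"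
proof -
  have "step_integral s N (Q ^ (l + 2)) \<le> Q\<^sup>2 * (s 0 + (Q - 1) * (\<Sum>i<l. M i * Q ^ i))"
    if "l \<le> L" for l
    using that
  proof (induction l)
    case 0
    have "step_integral s N (Q\<^sup>2) - step_integral s N 0 \<le> (Q\<^sup>2 - 0) * s (nat \<lfloor>0::real\<rfloor>)"
      by (rule step_integral_diff_le) auto
    then show ?case
      by (simp add: step_integral_0 power2_eq_square)
  next
    case (Suc l)
    define x y where "x = Q ^ (l + 2)" and "y = Q ^ (Suc l + 2)"
    have xy: "0 \<le> x" "x \<le> y" "y - x = Q\<^sup>2 * ((Q - 1) * Q ^ l)"
      using \<open>Q \<ge> 1\<close>
      by (auto simp: x_def y_def field_simps power2_eq_square intro: mult_right_mono)
    have "step_integral s N y - step_integral s N x \<le> (y - x) * s (nat \<lfloor>x\<rfloor>)"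
      by (rule step_integral_diff_le[OF xy(1,2)])
    also have "\<dots> \<le> (y - x) * M l"
      using M[of l] Suc.prems xy by (intro mult_left_mono) (auto simp: x_def)
    also have "\<dots> = Q\<^sup>2 * ((Q - 1) * (M l * Q ^ l))"
      unfolding xy(3) by simp
    finally show ?case
      using Suc by (simp add: x_def y_def distrib_left)
  qed
  from this[OF order_refl] show ?thesis
    using assms by (simp add: step_integral_eq_sum)
qed

end

section \<open>Medians and decreasing enumerations\<close>

text \<open>After sorting, the \<open>c\<close> values below \<open>v\<close> fill the first
  \<open>c\<close> positions; being a strict minority, they reach no middle position.\<close>

lemma median_ge:
  assumes "2 * length (filter (\<lambda>x. x < v) xs) < length xs"
  shows "v \<le> median xs"
proof -
  define s where "s = sort xs"
  define l where "l = length xs"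
  define c where "c = length (filter (\<lambda>x. x < v) xs)"
  have ls: "length s = l"
    by (simp add: s_def l_def)
  have c: "c = card {i. i < l \<and> s ! i < v}"
  proof -
    have "mset (filter (\<lambda>x. x < v) s) = mset (filter (\<lambda>x. x < v) xs)"
      by (simp add: s_def)
    then have "c = length (filter (\<lambda>x. x < v) s)"
      unfolding c_def by (metis size_mset)
    then show ?thesis
      by (simp add: length_filter_conv_card ls)
  qed
  have ge: "v \<le> s ! k" if "c \<le> k" "k < l" for k
  proof (rule ccontr)
    assume "\<not> v \<le> s ! k"
    then have "s ! i < v" if "i \<le> k" for i
      using that \<open>k < l\<close> sorted_nth_mono[of s i k] ls by (fastforce simp: s_def)
    then have "{..k} \<subseteq> {i. i < l \<and> s ! i < v}"
      using \<open>k < l\<close> by auto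
    from card_mono[OF _ this] show False
      using that c by simp
  qed
  have "2 * c < l"
    using assms by (simp add: c_def l_def)
  \<comment> \<open>For even \<open>l\<close>, parity improves \<open>2 * c < l\<close> to
    \<open>c \<le> l div 2 - 1\<close>, which covers the lower middle position as well.\<close>
  then have "v \<le> s ! (l div 2)" "even l \<Longrightarrow> v \<le> s ! (l div 2 - 1)"
    by (auto intro!: ge elim!: evenE)
  then show ?thesis
    unfolding median_def Let_def s_def[symmetric] l_def[symmetric] by auto
qed

text \<open>Symmetric: the values above \<open>v\<close> fill the last \<open>c\<close>
  positions.\<close>

lemma median_le:
  assumes "2 * length (filter (\<lambda>x. v < x) xs) < length xs"
  shows "median xs \<le> v"
proof -
  define s where "s = sort xs"
  define l where "l = length xs"
  define c where "c = length (filter (\<lambda>x. v < x) xs)"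
  have ls: "length s = l"
    by (simp add: s_def l_def)
  have c: "c = card {i. i < l \<and> v < s ! i}"
  proof -
    have "mset (filter (\<lambda>x. v < x) s) = mset (filter (\<lambda>x. v < x) xs)"
      by (simp add: s_def)
    then have "c = length (filter (\<lambda>x. v < x) s)"
      unfolding c_def by (metis size_mset)
    then show ?thesis
      by (simp add: length_filter_conv_card ls)
  qed
  have le: "s ! k \<le> v" if "k + c < l" for k
  proof (rule ccontr)
    assume "\<not> s ! k \<le> v"
    then have "v < s ! i" if "k \<le> i" "i < l" for i
      using that sorted_nth_mono[of s k i] ls by (fastforce simp: s_def)
    then have "{k..<l} \<subseteq> {i. i < l \<and> v < s ! i}"
      by auto
    from card_mono[OF _ this] show False
      using that c by simp
  qed
  have "2 * c < l"
    using assms by (simp add: c_def l_def)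
  then have "s ! (l div 2) \<le> v" "even l \<Longrightarrow> s ! (l div 2 - 1) \<le> v"
    by (auto intro!: le elim!: evenE)
  then show ?thesis
    unfolding median_def Let_def s_def[symmetric] l_def[symmetric] by auto
qed

lemma obtain_decreasing_enumeration:
  fixes w :: "'a \<Rightarrow> real"
  assumes "finite X"
  obtains e where "bij_betw e {..<card X} X"
    and "\<And>i j. i \<le> j \<Longrightarrow> j < card X \<Longrightarrow> w (e j) \<le> w (e i)"
proof -
  obtain xs where xs: "set xs = X" "distinct xs"
    using finite_distinct_list[OF assms] by blast
  define ys where "ys = sort_key (\<lambda>x. - w x) xs"
  have ys: "set ys = X" "distinct ys" "sorted (map (\<lambda>x. - w x) ys)"
    using xs by (auto simp: ys_def)
  then have len: "length ys = card X"
    using distinct_card by metis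
  show thesis
  proof
    show "bij_betw ((!) ys) {..<card X} X"
      using ys len by (auto intro: bij_betw_nth)
    show "w (ys ! j) \<le> w (ys ! i)" if "i \<le> j" "j < card X" for i j
      using sorted_nth_mono[OF ys(3), of i j] that len by simp
  qed
qed

section \<open>Random affine maps over a finite field\<close>

lemma pair_pmf_of_set:
  assumes "finite A" "finite B" "A \<noteq> {}" "B \<noteq> {}"
  shows "pair_pmf (pmf_of_set A) (pmf_of_set B) = pmf_of_set (A \<times> B)"
proof (rule pmf_eqI)
  fix z
  show "pmf (pair_pmf (pmf_of_set A) (pmf_of_set B)) z = pmf (pmf_of_set (A \<times> B)) z"
    using assms by (cases z) (simp add: pmf_pair card_cartesian_product indicator_times)
qed

lemma prob_pair_pmf_Times:
  "measure_pmf.prob (pair_pmf p p') (X \<times> Y) = measure_pmf.prob p X * measure_pmf.prob p' Y"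
proof -
  \<comment> \<open>Cutting down to the supports makes both factors countable, as
    \<open>measure_pmf_prob_product\<close> requires.\<close>
  have "measure_pmf.prob (pair_pmf p p') (X \<times> Y) =
      measure_pmf.prob (pair_pmf p p') ((X \<inter> set_pmf p) \<times> (Y \<inter> set_pmf p'))"
    by (subst measure_Int_set_pmf[symmetric]) (simp add: Times_Int_Times)
  also have "\<dots> = measure_pmf.prob p X * measure_pmf.prob p' Y"
    by (subst measure_pmf_prob_product) (auto simp: measure_Int_set_pmf)
  finally show ?thesis .
qed

lemma prob_Pi_pmf_uniform_ball:
  fixes G :: "'f::finite set"
  assumes "finite I" "J \<subseteq> I"
  shows "measure_pmf.prob (Pi_pmf I d (\<lambda>_. pmf_of_set UNIV)) {f. \<forall>j\<in>J. f j \<in> G} =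
    (real (card G) / real CARD('f)) ^ card J"
proof -
  have fJ: "finite J"
    using assms finite_subset by blast
  \<comment> \<open>On the support, functions take the value \<open>d\<close> outside
    \<open>I\<close>, so the event can be replaced by a product set.\<close>
  have "measure_pmf.prob (Pi_pmf I d (\<lambda>_. pmf_of_set UNIV)) {f. \<forall>j\<in>J. f j \<in> G} =
      measure_pmf.prob (Pi_pmf I d (\<lambda>_. pmf_of_set UNIV))
        (PiE_dflt I d (\<lambda>j. if j \<in> J then G else UNIV))"
    by (intro measure_prob_cong_0)
       (use assms in \<open>auto simp: PiE_dflt_def pmf_Pi split: if_splits\<close>)
  also have "\<dots> = (\<Prod>j\<in>I. if j \<in> J then real (card G) / real CARD('f) else 1)"
    using assms by (subst measure_Pi_pmf_PiE_dflt)
      (auto simp: measure_pmf_of_set intro!: prod.cong)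
  also have "\<dots> = (\<Prod>j\<in>J. real (card G) / real CARD('f))"
    using assms by (intro prod.mono_neutral_cong_right) auto
  finally show ?thesis
    by simp
qed

text \<open>If \<open>x \<noteq> y\<close> differ at coordinate \<open>c\<close>, then in each row \<open>j\<close> the pair \<open>(A j c, b j)\<close> can be traded
  bijectively for \<open>((A x + b) j, (A y + b) j)\<close>.\<close>

lemma prob_uniform_affine_pair:
  fixes x y :: "'f::{field,finite} Matrix.vec" and G H :: "'f set"
  assumes x: "x \<in> carrier_vec n" and y: "y \<in> carrier_vec n" and "x \<noteq> y"
  shows "measure_pmf.prob (pair_pmf (uniform_mat m n) (uniform_vec m))
      {(A, b). \<forall>j<m. (A *\<^sub>v x + b) $ j \<in> G \<and> (A *\<^sub>v y + b) $ j \<in> H} =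
    (real (card G) / real CARD('f)) ^ m * (real (card H) / real CARD('f)) ^ m"
proof -
  obtain c where c: "c < n" "x $ c \<noteq> y $ c"
    using assms by (metis carrier_vecD eq_vecI)
  define I where "I = {0..<m} \<times> {0..<n}"
  define SA where "SA = PiE_dflt I (0::'f) (\<lambda>_. UNIV)"
  define SB where "SB = PiE_dflt {0..<m} (0::'f) (\<lambda>_. UNIV)"
  define PA where "PA = Pi_pmf I (0::'f) (\<lambda>_. pmf_of_set UNIV)"
  define PB where "PB = Pi_pmf {0..<m} (0::'f) (\<lambda>_. pmf_of_set UNIV)"
  define row where "row z f g j = (\<Sum>k<n. f (j, k) * z $ k) + g j"
    for z :: "'f Matrix.vec" and f :: "nat \<times> nat \<Rightarrow> 'f" and g :: "nat \<Rightarrow> 'f" and j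
  \<comment> \<open>The trade: column \<open>c\<close> of the matrix becomes the first image and the
    offset the second. The value 0 outside the rows keeps the result in \<open>SB\<close>.\<close>
  define \<phi> where "\<phi> = (\<lambda>(f, g).
     (\<lambda>(j, k). if j < m \<and> k = c then row x f g j else f (j, k),
      \<lambda>j. if j < m then row y f g j else 0))"
  have fin: "finite SA" "finite SB" "SA \<noteq> {}" "SB \<noteq> {}"
    by (auto simp: SA_def SB_def I_def)
  have PAB: "pair_pmf PA PB = pmf_of_set (SA \<times> SB)"
    unfolding PA_def PB_def using fin
    by (subst (1 2) Pi_pmf_of_set) (auto simp: pair_pmf_of_set SA_def SB_def I_def)
  have maps: "\<phi> ` (SA \<times> SB) \<subseteq> SA \<times> SB"
    using c by (auto simp: \<phi>_def SA_def SB_def I_def PiE_dflt_def)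
  have inj: "inj_on \<phi> (SA \<times> SB)"
  proof (intro inj_onI, clarify)
    fix f g f' g' assume mem: "f \<in> SA" "g \<in> SB" "f' \<in> SA" "g' \<in> SB"
      and eq: "\<phi> (f, g) = \<phi> (f', g')"
    have eq1: "(if j < m \<and> k = c then row x f g j else f (j, k)) =
        (if j < m \<and> k = c then row x f' g' j else f' (j, k))" for j k
      using eq by (auto simp: \<phi>_def fun_eq_iff)
    have eq2: "row y f g j = row y f' g' j" if "j < m" for j
      using eq that by (auto simp: \<phi>_def fun_eq_iff split: if_splits)
    have off: "f (j, k) = f' (j, k)" if "k \<noteq> c" for j k
      using eq1[of j k] that by simp
    have split: "row z f g j - row z f' g' j = (f (j, c) - f' (j, c)) * z $ c + (g j - g' j)"
      if "j < m" for z j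
    proof -
      have "row z f g j - row z f' g' j = (\<Sum>k<n. (f (j, k) - f' (j, k)) * z $ k) + (g j - g' j)"
        by (simp add: row_def sum_subtractf algebra_simps)
      also have "(\<Sum>k<n. (f (j, k) - f' (j, k)) * z $ k) =
          (\<Sum>k\<in>{c}. (f (j, k) - f' (j, k)) * z $ k)"
        using c off by (intro sum.mono_neutral_right) auto
      finally show ?thesis by simp
    qed
    \<comment> \<open>Two equations in the two differences, with determinant
      \<open>x $ c - y $ c \<noteq> 0\<close>; subtracting them eliminates
      \<open>g j - g' j\<close>.\<close>
    have at_c: "f (j, c) = f' (j, c)" "g j = g' j" if "j < m" for j
    proof -
      have "(f (j, c) - f' (j, c)) * x $ c + (g j - g' j) = 0"
        using split[OF that, of x] eq1[of j c] that by simp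
      moreover have "(f (j, c) - f' (j, c)) * y $ c + (g j - g' j) = 0"
        using split[OF that, of y] eq2[OF that] by simp
      moreover have "(f (j, c) - f' (j, c)) * (x $ c - y $ c) =
          ((f (j, c) - f' (j, c)) * x $ c + (g j - g' j)) -
          ((f (j, c) - f' (j, c)) * y $ c + (g j - g' j))"
        by (simp add: algebra_simps)
      ultimately have "(f (j, c) - f' (j, c)) * (x $ c - y $ c) = 0"
        by simp
      then show "f (j, c) = f' (j, c)"
        using c by simp
      then show "g j = g' j"
        using \<open>(f (j, c) - f' (j, c)) * x $ c + (g j - g' j) = 0\<close> by simp
    qed
    have "f (j, k) = f' (j, k)" for j k
      using eq1[of j k] at_c[of j] by (cases "j < m \<and> k = c") auto
    moreover have "g j = g' j" for j
      using at_c[of j] mem by (cases "j < m") (auto simp: SB_def PiE_dflt_def)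
    ultimately show "f = f' \<and> g = g'"
      by (auto simp: fun_eq_iff)
  qed
  \<comment> \<open>An injective self-map of a finite set is a bijection, hence preserves the
    uniform distribution.\<close>
  have "bij_betw \<phi> (SA \<times> SB) (SA \<times> SB)"
    using fin maps inj by (simp add: bij_betw_def endo_inj_surj)
  then have unif: "map_pmf \<phi> (pair_pmf PA PB) = pair_pmf PA PB"
    unfolding PAB using fin by (intro map_pmf_of_set_bij_betw) auto
  have "pair_pmf (uniform_mat m n) (uniform_vec m) =
      map_pmf (\<lambda>(f, g). (Matrix.mat m n f, Matrix.vec m g)) (pair_pmf PA PB)"
    by (simp add: uniform_mat_def uniform_vec_def PA_def PB_def I_def map_pair)
  moreover have "(Matrix.mat m n f *\<^sub>v z + Matrix.vec m g) $ j = row z f g j"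
    if "j < m" "z \<in> carrier_vec n" for f g z j
    using that by (auto simp: row_def scalar_prod_def lessThan_atLeast0)
  ultimately have "measure_pmf.prob (pair_pmf (uniform_mat m n) (uniform_vec m))
      {(A, b). \<forall>j<m. (A *\<^sub>v x + b) $ j \<in> G \<and> (A *\<^sub>v y + b) $ j \<in> H} =
    measure_pmf.prob (pair_pmf PA PB) {(f, g). \<forall>j<m. row x f g j \<in> G \<and> row y f g j \<in> H}"
    using x y by (auto intro!: arg_cong[where f = "measure_pmf.prob _"])
  \<comment> \<open>In the new coordinates the event is a product: column \<open>c\<close> lies in
    \<open>G\<close>, the offset in \<open>H\<close>.\<close>
  also have "\<dots> = measure_pmf.prob (map_pmf \<phi> (pair_pmf PA PB))
      ({f. \<forall>jk\<in>{0..<m} \<times> {c}. f jk \<in> G} \<times> {g. \<forall>j\<in>{0..<m}. g j \<in> H})"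
    by (auto simp: \<phi>_def intro!: arg_cong[where f = "measure_pmf.prob _"])
  also have "\<dots> = measure_pmf.prob PA {f. \<forall>jk\<in>{0..<m} \<times> {c}. f jk \<in> G} *
      measure_pmf.prob PB {g. \<forall>j\<in>{0..<m}. g j \<in> H}"
    unfolding unif by (rule prob_pair_pmf_Times)
  also have "\<dots> = (real (card G) / real CARD('f)) ^ m * (real (card H) / real CARD('f)) ^ m"
    unfolding PA_def PB_def using c
    by (subst (1 2) prob_Pi_pmf_uniform_ball) (auto simp: I_def card_cartesian_product)
  finally show ?thesis .
qed

text \<open>The pair version with \<open>H = UNIV\<close> and an auxiliary
  \<open>y \<noteq> x\<close>, which exists because \<open>n \<ge> 1\<close>.\<close>

lemma prob_uniform_affine:
  fixes x :: "'f::{field,finite} Matrix.vec" and G :: "'f set"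
  assumes x: "x \<in> carrier_vec n" and "n \<ge> 1"
  shows "measure_pmf.prob (pair_pmf (uniform_mat m n) (uniform_vec m))
      {(A, b). \<forall>j<m. (A *\<^sub>v x + b) $ j \<in> G} = (real (card G) / real CARD('f)) ^ m"
proof -
  define y where "y = Matrix.vec n (\<lambda>i. x $ i + 1)"
  have "y \<in> carrier_vec n"
    by (simp add: y_def)
  moreover have "x \<noteq> y"
  proof
    assume "x = y"
    then have "x $ 0 = x $ 0 + 1"
      using assms by (metis y_def index_vec less_eq_Suc_le One_nat_def)
    then show False
      by simp
  qed
  ultimately show ?thesis
    using prob_uniform_affine_pair[OF x, of y m G UNIV] by simp
qed

section \<open>Parameters of the algorithm\<close>

lemma wish_r_cases:
  assumes "wish_r q > 0"
  obtains "q = 2 * wish_r q + 1" | "q = 2 * wish_r q + 2"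
  using assms unfolding wish_r_def by linarith

lemma wish_ratio_bounds:
  assumes "wish_r q > 0"
  shows "2 < real q / real (wish_r q)" "real q / real (wish_r q) \<le> 4"
    "real q / real (wish_r q) \<le> real q"
proof -
  show "2 < real q / real (wish_r q)" "real q / real (wish_r q) \<le> 4"
    using assms by (auto simp: field_simps wish_r_def)
  have "real q * 1 \<le> real q * real (wish_r q)"
    using assms by (intro mult_left_mono) auto
  then show "real q / real (wish_r q) \<le> real q"
    using assms by (simp add: pos_divide_le_eq)
qed

text \<open>The gap \<open>1 / 2 - r / q\<close> is \<open>1 / (2 * q)\<close> for odd and
  \<open>1 / q\<close> for even \<open>q\<close>, hence separate closed forms. In both,
  \<open>1 / wish_gamma q r\<close> has order \<open>q\<^sup>2\<close>.\<close>

lemma wish_gamma_odd: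
  assumes "q = 2 * r + 1" "r > 0"
  shows "wish_gamma q r = 1 / (12 * real r * real q)"
proof -
  have gap: "1 / 2 - real r / real q = 1 / (2 * real q)"
    using assms by (simp add: field_simps)
  have "q > 0"
    using assms by simp
  then show ?thesis
    using assms(2) unfolding wish_gamma_def gap by (simp add: power2_eq_square)
qed

lemma wish_gamma_even:
  assumes "q = 2 * r + 2" "r > 0"
  shows "wish_gamma q r = 1 / (3 * real r * real q)"
proof -
  have gap: "1 / 2 - real r / real q = 1 / real q"
    using assms by (simp add: field_simps)
  have "q > 0"
    using assms by simp
  then show ?thesis
    using assms(2) unfolding wish_gamma_def gap by (simp add: power2_eq_square)
qed

lemma wish_gamma_bounds:
  assumes "wish_r q > 0"
  shows "wish_gamma q (wish_r q) > 0" "12 \<le> 1 / wish_gamma q (wish_r q)"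
proof -
  have r: "real (wish_r q) \<ge> 1"
    using assms by simp
  from assms have "wish_gamma q (wish_r q) > 0 \<and> 12 \<le> 1 / wish_gamma q (wish_r q)"
  proof (cases rule: wish_r_cases)
    case 1
    then have "real q \<ge> 1"
      by linarith
    then show ?thesis
      using r mult_mono[of 1 "real (wish_r q)" 1 "real q"] assms
      unfolding wish_gamma_odd[OF 1 assms] by simp
  next
    case 2
    then have "real q \<ge> 4"
      using assms by linarith
    then show ?thesis
      using r mult_mono[of 4 "real q" 1 "real (wish_r q)"] assms
      unfolding wish_gamma_even[OF 2 assms] by simp
  qed
  then show "wish_gamma q (wish_r q) > 0" "12 \<le> 1 / wish_gamma q (wish_r q)"
    by auto
qed

text \<open>The exponent gained by Hoeffding's inequality with failure probability \<open>1 / (1 + q / r)\<close>,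
  measured in units of \<open>wish_gamma\<close>.\<close>

definition wish_exponent :: "nat \<Rightarrow> nat \<Rightarrow> real" where
  "wish_exponent q r = 2 * (1 / 2 - 1 / (1 + real q / real r))\<^sup>2 / wish_gamma q r"

text \<open>The failure probability \<open>1 / (1 + q / r)\<close> is below 1/3, so its gap to 1/2
  exceeds 1/6, while \<open>wish_gamma\<close> has order \<open>1 / q\<^sup>2\<close>. The exponent
  thus grows quadratically; the stated bound is what is needed to dominate
  \<open>log 2 q\<close>.\<close>

lemma wish_exponent_ge:
  assumes "wish_r q > 0"
  shows "wish_exponent q (wish_r q) \<ge> max 2 (real q / 2)"
proof -
  define R where "R = real (wish_r q)"
  have R: "R \<ge> 1"
    using assms by (simp add: R_def)
  have gap: "1 / 2 - 1 / (1 + real q / R) = (real q - R) / (2 * (real q + R))"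
    using R by (simp add: field_simps)
  have exponent: "wish_exponent q (wish_r q) =
      ((real q - R) / (real q + R))\<^sup>2 / 2 / wish_gamma q (wish_r q)"
    unfolding wish_exponent_def R_def[symmetric] gap
    by (simp add: power_divide power_mult_distrib del: distrib_left_numeral)
  from assms show ?thesis
  proof (cases rule: wish_r_cases)
    case 1
    then have q: "real q = 2 * R + 1"
      by (metis R_def of_nat_1 of_nat_add of_nat_mult of_nat_numeral)
    have "(1 / 3)\<^sup>2 \<le> ((R + 1) / (3 * R + 1))\<^sup>2"
      using R by (intro power_mono) (auto simp: field_simps)
    then have sq: "1 / 9 \<le> ((R + 1) / (3 * R + 1))\<^sup>2"
      by (simp add: power2_eq_square)
    define z where "z = R * R"
    have "R \<le> z"
      using R by (simp add: z_def)
    then have "max 2 (real q / 2) \<le> 4 / 3 * z + 2 / 3 * R"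
      using R by (simp add: q)
    also have "\<dots> = 6 * R * (2 * R + 1) * (1 / 9)"
      by (simp add: z_def algebra_simps)
    also have "\<dots> \<le> 6 * R * (2 * R + 1) * ((R + 1) / (3 * R + 1))\<^sup>2"
      using R sq by (intro mult_left_mono) auto
    also have "\<dots> = wish_exponent q (wish_r q)"
      unfolding exponent wish_gamma_odd[OF 1 assms] by (simp add: q flip: R_def)
    finally show ?thesis .
  next
    case 2
    then have q: "real q = 2 * R + 2"
      by (metis R_def of_nat_add of_nat_mult of_nat_numeral)
    have "1 \<le> R * R" "1 \<le> R * (R * R)"
      using R mult_mono[of 1 R 1 R] mult_mono[of 1 R 1 "R * R"] by auto
    \<comment> \<open>For even \<open>q\<close> the estimate 1/3 for the ratio is too weak at
      \<open>R = 1\<close>, so the exact ratio is kept.\<close>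
    then have "(3 * R + 2)\<^sup>2 \<le> 3 * R * (R + 2)\<^sup>2"
      by (simp add: power2_eq_square algebra_simps)
    then have "1 \<le> 3 * R * ((R + 2) / (3 * R + 2))\<^sup>2"
      using R by (simp add: power_divide le_divide_eq)
    then have "(R + 1) * 1 \<le> (R + 1) * (3 * R * ((R + 2) / (3 * R + 2))\<^sup>2)"
      using R by (intro mult_left_mono) auto
    moreover have "max 2 (real q / 2) \<le> (R + 1) * 1"
      using R by (simp add: q)
    ultimately have "max 2 (real q / 2) \<le> (R + 1) * (3 * R * ((R + 2) / (3 * R + 2))\<^sup>2)"
      by linarith
    also have "\<dots> = wish_exponent q (wish_r q)"
      unfolding exponent wish_gamma_even[OF 2 assms] by (simp add: q flip: R_def)
    finally show ?thesis .
  qed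
qed

lemma square_le_two_power: "4 \<le> n \<Longrightarrow> n\<^sup>2 \<le> (2::nat) ^ n"
proof (induction n rule: nat_induct_at_least)
  case (Suc n)
  have "4 * n \<le> n * n"
    using Suc by simp
  moreover have "(Suc n)\<^sup>2 = n * n + 2 * n + 1" "n\<^sup>2 = n * n"
    by (auto simp: power2_eq_square)
  ultimately have "(Suc n)\<^sup>2 \<le> 2 * n\<^sup>2"
    using Suc.hyps by linarith
  then show ?case
    using Suc by simp
qed simp

lemma log2_le_max:
  assumes "q \<ge> 3"
  shows "log 2 (real q) \<le> max 2 (real q / 2)"
proof (cases "q = 3")
  case True
  \<comment> \<open>\<open>q\<^sup>2 \<le> 2 ^ q\<close> fails at 3, where the constant 2 in the
    maximum takes over.\<close>
  have "log 2 3 \<le> log 2 (2 ^ 2)"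
    by (subst log_le_cancel_iff) auto
  also have "\<dots> = 2"
    by (subst log_nat_power) auto
  finally show ?thesis
    using True by simp
next
  case False
  then have "real (q\<^sup>2) \<le> real (2 ^ q)"
    using assms square_le_two_power[of q] by (subst of_nat_le_iff) simp
  then have "log 2 (real q ^ 2) \<le> log 2 (2 ^ q)"
    using assms by (subst log_le_cancel_iff) auto
  then have "2 * log 2 (real q) \<le> real q"
    using assms by (simp add: log_nat_power)
  then show ?thesis
    by simp
qed

text \<open>Equality at \<open>e = 2\<close>; from there the tangent of the right-hand side has
  slope \<open>2 * ln 2 > 1\<close>.\<close>

lemma le_two_powr_minus_one:
  assumes "e \<ge> (2::real)"
  shows "e \<le> 2 powr (e - 1)"
proof -
  have "(e - 2) * (1 / 2) \<le> (e - 2) * ln 2"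
    using assms ln2_ge_two_thirds by (intro mult_left_mono) auto
  then have "e \<le> 2 * (1 + (e - 2) * ln 2)"
    by simp
  also have "\<dots> \<le> 2 * exp ((e - 2) * ln 2)"
    by (intro mult_left_mono exp_ge_add_one_self) auto
  also have "\<dots> = 2 powr 1 * 2 powr (e - 2)"
    by (simp add: powr_def)
  also have "\<dots> = 2 powr (e - 1)"
    by (subst powr_add[symmetric]) simp
  finally show ?thesis .
qed

lemma log_ratio_bounds:
  assumes "wish_r q > 0"
  defines "Q \<equiv> real q / real (wish_r q)"
  shows "1 \<le> log Q (real q)" "log Q (real q) \<le> log 2 (real q)"
proof -
  have Q: "2 < Q" "Q \<le> real q"
    using wish_ratio_bounds[OF assms(1)] by (auto simp: Q_def)
  show "1 \<le> log Q (real q)"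
    using Q by (simp add: le_log_iff)
  show "log Q (real q) \<le> log 2 (real q)"
    using Q by (simp add: log_def frac_le)
qed

text \<open>A median fails with probability at most \<open>(\<delta> / (2 * n)) powr e\<close>.
  There are at most \<open>n * e\<close> levels after subtracting one, and
  \<open>2 * n * e \<le> (2 * n) powr e\<close>, so the total is at most
  \<open>\<delta> powr e \<le> \<delta>\<close>.\<close>

lemma wish_failure_budget:
  assumes "n \<ge> 1" "wish_r q > 0" "0 < \<delta>" "\<delta> < 1"
  defines "r \<equiv> wish_r q"
  shows "2 * real (wish_levels n q r - 1) *
      exp (- (2 * (1 / 2 - 1 / (1 + real q / real r))\<^sup>2 * real (wish_reps n q r \<delta>))) \<le> \<delta>"
proof -
  define e where "e = wish_exponent q r"
  define x where "x = real n * log (real q / real r) (real q)"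
  define y where "y = ln (2 * real n / \<delta>)"
  have q: "q \<ge> 3"
    using assms by (simp add: wish_r_def)
  have e: "e \<ge> 2" "log 2 (real q) \<le> e"
    using wish_exponent_ge[OF assms(2)] log2_le_max[OF q] by (auto simp: e_def r_def)
  have \<gamma>: "wish_gamma q r > 0"
    using wish_gamma_bounds[OF assms(2)] by (simp add: r_def)
  have "x \<ge> 0"
    using log_ratio_bounds[OF assms(2)] by (simp add: x_def r_def)
  \<comment> \<open>Dropping one level undoes the rounding of the ceiling.\<close>
  then have "real (wish_levels n q r - 1) \<le> x"
    unfolding wish_levels_def x_def[symmetric] by linarith
  also have "x \<le> real n * e"
    unfolding x_def using log_ratio_bounds[OF assms(2)] e
    by (intro mult_left_mono) (auto simp: r_def)
  also have "\<dots> \<le> real n powr e * 2 powr (e - 1)"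
    using assms(1) e le_two_powr_minus_one[of e] powr_mono[of 1 e "real n"]
    by (intro mult_mono) auto
  finally have "2 * real (wish_levels n q r - 1) \<le> real n powr e * (2 powr 1 * 2 powr (e - 1))"
    by simp
  also have "2 powr 1 * 2 powr (e - 1) = 2 powr e"
    by (subst powr_add[symmetric]) simp
  finally have levels: "2 * real (wish_levels n q r - 1) \<le> (2 * real n) powr e"
    by (simp add: powr_mult mult.commute)
  have "y / wish_gamma q r \<le> real (wish_reps n q r \<delta>)"
    unfolding wish_reps_def y_def by (simp add: real_nat_ceiling_ge)
  then have "2 * (1 / 2 - 1 / (1 + real q / real r))\<^sup>2 * (y / wish_gamma q r) \<le>
      2 * (1 / 2 - 1 / (1 + real q / real r))\<^sup>2 * real (wish_reps n q r \<delta>)"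
    by (intro mult_left_mono) auto
  moreover have "2 * (1 / 2 - 1 / (1 + real q / real r))\<^sup>2 * (y / wish_gamma q r) = e * y"
    by (simp add: e_def wish_exponent_def)
  ultimately have "exp (- (2 * (1 / 2 - 1 / (1 + real q / real r))\<^sup>2 * real (wish_reps n q r \<delta>)))
      \<le> exp (- (e * y))"
    by simp
  also have "\<dots> = (\<delta> / (2 * real n)) powr e"
    using assms by (simp add: y_def powr_def ln_div algebra_simps)
  finally have "2 * real (wish_levels n q r - 1) *
      exp (- (2 * (1 / 2 - 1 / (1 + real q / real r))\<^sup>2 * real (wish_reps n q r \<delta>)))
    \<le> (2 * real n) powr e * (\<delta> / (2 * real n)) powr e"
    using levels by (intro mult_mono) auto
  also have "\<dots> = \<delta> powr e"
    using assms by (simp add: powr_divide)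
  also have "\<dots> \<le> \<delta> powr 1"
    using assms e by (intro powr_mono') auto
  finally show ?thesis
    using assms by simp
qed

text \<open>The count is a product of two ceilings. Each costs at most a factor 2, giving the 4; the
  remaining factor absorbs the \<open>ln 2\<close> in \<open>ln (2 * m / \<epsilon>)\<close> and is
  finite because \<open>c > 1\<close>.\<close>

lemma wish_calls_bounds:
  assumes "wish_r p > 0" "m \<ge> 1" "\<epsilon> > 0" "c > 1" "c \<le> real m / \<epsilon>"
  defines "r \<equiv> wish_r p"
  defines "K \<equiv> log (real p / real r) (real p) / wish_gamma p r * (real m * ln (real m / \<epsilon>))"
  shows "K \<le> real (wish_calls m p r \<epsilon>)"
    and "real (wish_calls m p r \<epsilon>) \<le> 4 * (1 + ln 2 / ln c) * K" and "K \<ge> 0"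
proof -
  define L where "L = log (real p / real r) (real p)"
  define g where "g = 1 / wish_gamma p r"
  define v where "v = ln (real m / \<epsilon>)"
  have L: "L \<ge> 1"
    using log_ratio_bounds[OF assms(1)] by (simp add: L_def r_def)
  have g: "g \<ge> 12"
    using wish_gamma_bounds[OF assms(1)] by (simp add: g_def r_def)
  have v: "v \<ge> ln c" "ln c > 0"
    using assms by (auto simp: v_def)
  have ln2: "ln (2 * real m / \<epsilon>) = ln 2 + v"
    using assms by (simp add: v_def ln_div ln_mult)
  have K: "K = (real m * L) * (g * v)"
    by (simp add: K_def L_def g_def v_def)
  show "K \<ge> 0"
    unfolding K using L g v by simp
  have calls: "real (wish_calls m p r \<epsilon>) = real (wish_levels m p r) * real (wish_reps m p r \<epsilon>)"
    by (simp add: wish_calls_def wish_queries_def card_cartesian_product)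
  have mL: "real m * L \<ge> 1"
    using L assms(2) mult_mono[of 1 "real m" 1 L] by simp
  have lev: "real m * L \<le> real (wish_levels m p r)" "real (wish_levels m p r) \<le> 2 * (real m * L)"
    unfolding wish_levels_def L_def[symmetric] using mL by linarith+
  \<comment> \<open>The argument of the ceiling is at least 8; any bound of at least 1 allows
    rounding up within a factor 2.\<close>
  have "12 * (2 / 3) \<le> g * (ln 2 + v)"
    using g v ln2_ge_two_thirds by (intro mult_mono) auto
  then have rep: "g * (ln 2 + v) \<le> real (wish_reps m p r \<epsilon>)"
    "real (wish_reps m p r \<epsilon>) \<le> 2 * (g * (ln 2 + v))"
    unfolding wish_reps_def ln2 g_def[symmetric] by linarith+
  have "g * v \<le> g * (ln 2 + v)"
    using g by simp
  then have "g * v \<le> real (wish_reps m p r \<epsilon>)"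
    using rep by simp
  then show "K \<le> real (wish_calls m p r \<epsilon>)"
    unfolding K calls using lev mL g v by (intro mult_mono) auto
  have "ln 2 * 1 \<le> ln 2 * (v / ln c)"
    using v by (intro mult_left_mono) auto
  then have "ln 2 + v \<le> (1 + ln 2 / ln c) * v"
    by (simp add: algebra_simps)
  then have "g * (ln 2 + v) \<le> g * ((1 + ln 2 / ln c) * v)"
    using g by (intro mult_left_mono) auto
  then have "real (wish_reps m p r \<epsilon>) \<le> 2 * (g * ((1 + ln 2 / ln c) * v))"
    using rep by simp
  then have "real (wish_calls m p r \<epsilon>) \<le> 2 * (real m * L) * (2 * (g * ((1 + ln 2 / ln c) * v)))"
    unfolding calls using lev mL by (intro mult_mono) auto
  then show "real (wish_calls m p r \<epsilon>) \<le> 4 * (1 + ln 2 / ln c) * K"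
    unfolding K by (simp add: mult_ac)
qed

text \<open>With \<open>Q = p / r\<close>, \<open>p * (Q - 2) = Q * (p - 2 * r)\<close> is at most
  \<open>4 * 2\<close>, and \<open>Q + 2\<close> is at most 6, whence 48.\<close>

lemma wish_ratio_square_diff_le:
  assumes "wish_r p > 0" "m \<ge> 1" "m < p"
  shows "\<bar>(real p / real (wish_r p))\<^sup>2 - 4\<bar> \<le> 48 * (1 / real m)"
proof -
  define r where "r = wish_r p"
  have "2 * r \<le> p" "p \<le> 2 * r + 2" "1 \<le> r"
    using assms by (auto simp: r_def wish_r_def)
  then have r: "2 * real r \<le> real p" "real p \<le> 2 * real r + 2" "1 \<le> real r"
    by linarith+
  define Q where "Q = real p / real r"
  have Q: "2 \<le> Q" "Q \<le> 4"
    using r by (auto simp: Q_def field_simps)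
  have "real m * (Q - 2) \<le> real p * (Q - 2)"
    using assms Q by (intro mult_right_mono) auto
  also have "\<dots> = Q * (real p - 2 * real r)"
    using r by (simp add: Q_def field_simps)
  also have "\<dots> \<le> 4 * 2"
    using Q r by (intro mult_mono) auto
  finally have "Q - 2 \<le> 8 * (1 / real m)"
    using assms by (simp add: field_simps)
  then have "(Q - 2) * (Q + 2) \<le> 8 * (1 / real m) * 6"
    using Q by (intro mult_mono) auto
  moreover have "(Q - 2) * (Q + 2) = Q\<^sup>2 - 4"
    by (simp add: power2_eq_square algebra_simps)
  moreover have "(Q - 2) * (Q + 2) \<ge> 0"
    using Q by simp
  ultimately show ?thesis
    by (simp add: Q_def r_def)
qed

section \<open>Single oracle calls\<close>

lemma prob_mono_on_support:
  assumes "\<And>x. x \<in> set_pmf p \<Longrightarrow> x \<in> X \<Longrightarrow> x \<in> Y"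
  shows "measure_pmf.prob p X \<le> measure_pmf.prob p Y"
  using assms by (intro measure_pmf.finite_measure_mono_AE) (auto simp: AE_measure_pmf_iff)

lemma enum_less_iff:
  assumes "bij_betw \<alpha> {0..<CARD('f::finite)} (UNIV :: 'f set)" "r < CARD('f)"
  shows "enum_less \<alpha> z (\<alpha> r) \<longleftrightarrow> z \<in> \<alpha> ` {..<r}"
proof
  assume "enum_less \<alpha> z (\<alpha> r)"
  then obtain a b where ab: "a < b" "b < CARD('f)" "z = \<alpha> a" "\<alpha> r = \<alpha> b"
    by (auto simp: enum_less_def)
  then have "r = b"
    using assms by (auto simp: bij_betw_def inj_on_def)
  then show "z \<in> \<alpha> ` {..<r}"
    using ab by auto
qed (use assms in \<open>auto simp: enum_less_def\<close>)

lemma set_pmf_uniform_mat: "set_pmf (uniform_mat m n) \<subseteq> carrier_mat m n"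
  by (auto simp: uniform_mat_def)

lemma set_pmf_uniform_vec: "set_pmf (uniform_vec m) \<subseteq> carrier_vec m"
  by (auto simp: uniform_vec_def)

context
  fixes n r :: nat and D :: "real mat" and \<alpha> :: "nat \<Rightarrow> 'f::{field,finite}"
  assumes n: "n \<ge> 1" and D: "D \<in> carrier_mat n n"
    and D_nonneg: "\<And>i j. i < n \<Longrightarrow> j < n \<Longrightarrow> D $$ (i, j) \<ge> 0"
    and n_less: "n < CARD('f)" and \<alpha>: "bij_betw \<alpha> {0..<CARD('f)} UNIV"
    and r: "r < CARD('f)"
begin

text \<open>The event that \<open>\<sigma>\<close> survives \<open>i\<close> constraints. The order
  enters only through a set of \<open>r\<close> field elements, the form the affine-map lemmas ask
  for.\<close>

definition hit :: "nat \<Rightarrow> (nat \<Rightarrow> nat) \<Rightarrow> ('f mat \<times> 'f Matrix.vec) set" where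
  "hit i \<sigma> = {(A, b). \<forall>j<i. (A *\<^sub>v perm_vec \<alpha> n \<sigma> + b) $ j \<in> \<alpha> ` {..<r}}"

lemma perm_weight_nonneg: "\<sigma> permutes {0..<n} \<Longrightarrow> perm_weight D \<sigma> \<ge> 0"
  unfolding perm_weight_def using D D_nonneg permutes_in_image[of \<sigma> "{0..<n}"]
  by (intro prod_nonneg) auto

lemma perm_vec_neq:
  assumes "\<sigma> permutes {0..<n}" "\<tau> permutes {0..<n}" "\<sigma> \<noteq> \<tau>"
  shows "perm_vec \<alpha> n \<sigma> \<noteq> perm_vec \<alpha> n \<tau>"
proof
  assume eq: "perm_vec \<alpha> n \<sigma> = perm_vec \<alpha> n \<tau>"
  have "\<sigma> k = \<tau> k" for k
  proof (cases "k < n")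
    case True
    then have "\<alpha> (\<sigma> k) = \<alpha> (\<tau> k)"
      using eq by (metis perm_vec_def index_vec)
    moreover have "\<sigma> k < n" "\<tau> k < n"
      using True assms permutes_in_image[of _ "{0..<n}" k] by auto
    ultimately show ?thesis
      using \<alpha> n_less by (auto simp: bij_betw_def inj_on_def)
  next
    case False
    then show ?thesis
      using assms by (auto simp: permutes_def)
  qed
  then show False
    using assms by auto
qed

lemma card_threshold: "card (\<alpha> ` {..<r}) = r"
  using \<alpha> r by (subst card_image) (auto simp: bij_betw_def inj_on_def)

lemma prob_hit:
  "measure_pmf.prob (pair_pmf (uniform_mat i n) (uniform_vec i)) (hit i \<sigma>) =
    (real r / real CARD('f)) ^ i"
  unfolding hit_def using n by (subst prob_uniform_affine) (auto simp: perm_vec_def card_threshold)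

lemma prob_hit_pair:
  assumes "\<sigma> permutes {0..<n}" "\<tau> permutes {0..<n}" "\<sigma> \<noteq> \<tau>"
  shows "measure_pmf.prob (pair_pmf (uniform_mat i n) (uniform_vec i)) (hit i \<sigma> \<inter> hit i \<tau>) =
    ((real r / real CARD('f)) ^ i)\<^sup>2"
proof -
  have "hit i \<sigma> \<inter> hit i \<tau> = {(A, b). \<forall>j<i. (A *\<^sub>v perm_vec \<alpha> n \<sigma> + b) $ j \<in> \<alpha> ` {..<r} \<and>
      (A *\<^sub>v perm_vec \<alpha> n \<tau> + b) $ j \<in> \<alpha> ` {..<r}}"
    by (auto simp: hit_def)
  also have "measure_pmf.prob (pair_pmf (uniform_mat i n) (uniform_vec i)) \<dots> =
      (real r / real CARD('f)) ^ i * (real r / real CARD('f)) ^ i"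
    using prob_uniform_affine_pair[of "perm_vec \<alpha> n \<sigma>" n "perm_vec \<alpha> n \<tau>" i]
      perm_vec_neq[OF assms] by (simp add: perm_vec_def card_threshold)
  finally show ?thesis
    by (simp add: power2_eq_square)
qed

text \<open>On the support the dimensions are right, so the vector comparison of the oracle amounts
  to \<open>hit\<close>.\<close>

lemma max_oracle_eq:
  assumes "x \<in> set_pmf (pair_pmf (uniform_mat i n) (uniform_vec i))"
  defines "W \<equiv> perm_weight D ` {\<sigma>. \<sigma> permutes {0..<n} \<and> x \<in> hit i \<sigma>}"
  shows "max_oracle \<alpha> r D (fst x) (snd x) = (if W = {} then 0 else Max W)"
proof -
  obtain A b where x: "x = (A, b)"
    by (cases x)
  have "A \<in> carrier_mat i n" "b \<in> carrier_vec i"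
    using assms(1) subsetD[OF set_pmf_uniform_mat, of A i n] subsetD[OF set_pmf_uniform_vec, of b i]
    by (auto simp: x)
  then have "enum_vec_less \<alpha> (A *\<^sub>v perm_vec \<alpha> n \<sigma> + b)
      (\<alpha> r \<cdot>\<^sub>v Matrix.vec (dim_row A) (\<lambda>_. 1)) \<longleftrightarrow> x \<in> hit i \<sigma>" for \<sigma>
    using enum_less_iff[OF \<alpha> r] by (auto simp: x hit_def enum_vec_less_def)
  then have "{perm_weight D \<sigma> |\<sigma>. \<sigma> permutes {0..<n} \<and>
      enum_vec_less \<alpha> (A *\<^sub>v perm_vec \<alpha> n \<sigma> + b)
        (\<alpha> r \<cdot>\<^sub>v Matrix.vec (dim_row A) (\<lambda>_. 1))} = W"
    by (auto simp: W_def)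
  then show ?thesis
    by (simp only: max_oracle_def Let_def carrier_matD(1)[OF D] x fst_conv snd_conv)
qed

text \<open>These hold for every \<open>A\<close> and \<open>b\<close>, not just with high
  probability; they settle the upper bound at the first level and the lower bound at the
  last.\<close>

lemma max_oracle_bounds:
  "0 \<le> max_oracle \<alpha> r D A b"
  "max_oracle \<alpha> r D A b \<le> Max (perm_weight D ` {\<sigma>. \<sigma> permutes {0..<n}})"
proof -
  define V where "V = perm_weight D ` {\<sigma>. \<sigma> permutes {0..<n}}"
  define W where "W = {perm_weight D \<sigma> | \<sigma>. \<sigma> permutes {0..<n} \<and>
               enum_vec_less \<alpha> (A *\<^sub>v perm_vec \<alpha> n \<sigma> + b)
                 (\<alpha> r \<cdot>\<^sub>v Matrix.vec (dim_row A) (\<lambda>_. 1))}"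
  have oracle_eq: "max_oracle \<alpha> r D A b = (if W = {} then 0 else Max W)"
    unfolding max_oracle_def W_def Let_def carrier_matD(1)[OF D] by (rule refl)
  have fin: "finite V"
    by (simp add: V_def finite_permutations)
  have sub: "W \<subseteq> V"
    by (auto simp: V_def W_def)
  then have finW: "finite W"
    using fin finite_subset by blast
  have "perm_weight D id \<in> V"
    unfolding V_def by (intro imageI CollectI permutes_id)
  then have "V \<noteq> {}"
    by blast
  have nonneg: "\<forall>w\<in>V. w \<ge> 0"
    using perm_weight_nonneg by (auto simp: V_def)
  show "0 \<le> max_oracle \<alpha> r D A b"
    using Max_in[OF finW] sub nonneg by (auto simp: oracle_eq)
  show "max_oracle \<alpha> r D A b \<le> Max V"
    using Max_in[OF fin \<open>V \<noteq> {}\<close>] nonneg Max_mono[OF sub _ fin] by (auto simp: oracle_eq)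
qed

text \<open>A value above \<open>v\<close> is attained by a surviving member of \<open>T\<close>;
  the union bound applies. \<open>v \<ge> 0\<close> rules out the default 0 of an empty
  maximum.\<close>

lemma prob_max_oracle_gt:
  assumes T: "T \<subseteq> {\<sigma>. \<sigma> permutes {0..<n}}" and "v \<ge> 0"
    and rest: "\<And>\<sigma>. \<sigma> permutes {0..<n} \<Longrightarrow> \<sigma> \<notin> T \<Longrightarrow> perm_weight D \<sigma> \<le> v"
  shows "measure_pmf.prob (pair_pmf (uniform_mat i n) (uniform_vec i))
      {x. v < max_oracle \<alpha> r D (fst x) (snd x)} \<le> real (card T) * (real r / real CARD('f)) ^ i"
proof -
  have fin: "finite {\<sigma>. \<sigma> permutes {0..<n}}"
    by (simp add: finite_permutations)
  then have finT: "finite T"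
    using T finite_subset by blast
  have "measure_pmf.prob (pair_pmf (uniform_mat i n) (uniform_vec i))
      {x. v < max_oracle \<alpha> r D (fst x) (snd x)} \<le>
    measure_pmf.prob (pair_pmf (uniform_mat i n) (uniform_vec i)) (\<Union>\<sigma>\<in>T. hit i \<sigma>)"
  proof (rule prob_mono_on_support)
    fix x assume supp: "x \<in> set_pmf (pair_pmf (uniform_mat i n) (uniform_vec i))"
      and x: "x \<in> {x. v < max_oracle \<alpha> r D (fst x) (snd x)}"
    define W where "W = perm_weight D ` {\<sigma>. \<sigma> permutes {0..<n} \<and> x \<in> hit i \<sigma>}"
    have "max_oracle \<alpha> r D (fst x) (snd x) = (if W = {} then 0 else Max W)"
      unfolding W_def by (rule max_oracle_eq[OF supp])
    then have "W \<noteq> {}" "v < Max W"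
      using x \<open>v \<ge> 0\<close> by (auto split: if_splits)
    moreover have "finite W"
      unfolding W_def using fin by (auto intro: finite_subset)
    ultimately obtain w where "w \<in> W" "v < w"
      using Max_in by blast
    then obtain \<sigma> where "\<sigma> permutes {0..<n}" "x \<in> hit i \<sigma>" "v < perm_weight D \<sigma>"
      by (auto simp: W_def)
    then show "x \<in> (\<Union>\<sigma>\<in>T. hit i \<sigma>)"
      using rest[of \<sigma>] by auto
  qed
  also have "\<dots> \<le> (\<Sum>\<sigma>\<in>T. measure_pmf.prob (pair_pmf (uniform_mat i n) (uniform_vec i)) (hit i \<sigma>))"
    using finT by (intro measure_pmf.finite_measure_subadditive_finite) auto
  finally show ?thesis
    by (simp add: prob_hit)
qed

text \<open>A single survivor in \<open>T\<close> would force the value up to \<open>v\<close>, so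
  nobody in \<open>T\<close> survives; pairwise independence bounds the probability of that.\<close>

lemma prob_max_oracle_lt:
  assumes T: "T \<subseteq> {\<sigma>. \<sigma> permutes {0..<n}}"
    and top: "\<And>\<sigma>. \<sigma> \<in> T \<Longrightarrow> v \<le> perm_weight D \<sigma>"
  shows "measure_pmf.prob (pair_pmf (uniform_mat i n) (uniform_vec i))
      {x. max_oracle \<alpha> r D (fst x) (snd x) < v} \<le>
    1 / (1 + real (card T) * (real r / real CARD('f)) ^ i)"
proof -
  have fin: "finite {\<sigma>. \<sigma> permutes {0..<n}}"
    by (simp add: finite_permutations)
  then have finT: "finite T"
    using T finite_subset by blast
  have "measure_pmf.prob (pair_pmf (uniform_mat i n) (uniform_vec i))
      {x. max_oracle \<alpha> r D (fst x) (snd x) < v} \<le>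
    measure_pmf.prob (pair_pmf (uniform_mat i n) (uniform_vec i)) {x. \<forall>\<sigma>\<in>T. x \<notin> hit i \<sigma>}"
  proof (rule prob_mono_on_support)
    fix x assume supp: "x \<in> set_pmf (pair_pmf (uniform_mat i n) (uniform_vec i))"
      and x: "x \<in> {x. max_oracle \<alpha> r D (fst x) (snd x) < v}"
    define W where "W = perm_weight D ` {\<sigma>. \<sigma> permutes {0..<n} \<and> x \<in> hit i \<sigma>}"
    have oracle_eq: "max_oracle \<alpha> r D (fst x) (snd x) = (if W = {} then 0 else Max W)"
      unfolding W_def by (rule max_oracle_eq[OF supp])
    have finW: "finite W"
      unfolding W_def using fin by (auto intro: finite_subset)
    show "x \<in> {x. \<forall>\<sigma>\<in>T. x \<notin> hit i \<sigma>}"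
    proof (clarify)
      fix \<sigma> assume "\<sigma> \<in> T" "x \<in> hit i \<sigma>"
      then have "perm_weight D \<sigma> \<in> W"
        using T by (auto simp: W_def)
      then show False
        using x oracle_eq top[OF \<open>\<sigma> \<in> T\<close>] Max_ge[OF finW, of "perm_weight D \<sigma>"]
        by (auto split: if_splits)
    qed
  qed
  also have "\<dots> \<le> 1 / (1 + real (card T) * (real r / real CARD('f)) ^ i)"
    using T finT by (intro prob_none_pairwise_indep prob_hit prob_hit_pair) auto
  finally show ?thesis .
qed

end

text \<open>Hoeffding's bound on the repetitions of level \<open>i\<close>. The event is the
  negation of the strict minority required by the median lemmas.\<close>

lemma prob_wish_samples_half_of_rare_le:
  fixes B :: "('f::{field,finite} mat \<times> 'f Matrix.vec) set"
  assumes "i \<in> {1..wish_levels n q r}" "\<rho> \<le> 1 / 2"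
    and "measure_pmf.prob (pair_pmf (uniform_mat i n) (uniform_vec i)) B \<le> \<rho>"
  shows "measure_pmf.prob (wish_samples n q r \<delta>)
      {S. wish_reps n q r \<delta> \<le> 2 * card {k \<in> {1..wish_reps n q r \<delta>}. S (i, k) \<in> B}}
    \<le> exp (- (2 * (1 / 2 - \<rho>)\<^sup>2 * real (wish_reps n q r \<delta>)))"
proof -
  define l where "l = wish_reps n q r \<delta>"
  define J where "J = {i} \<times> {1..l}"
  have cardJ: "card J = l"
    by (simp add: J_def card_cartesian_product)
  have "card {j \<in> J. S j \<in> B} = card {k \<in> {1..l}. S (i, k) \<in> B}"
    for S :: "nat \<times> nat \<Rightarrow> 'f mat \<times> 'f Matrix.vec"
  proof -
    have "{j \<in> J. S j \<in> B} = Pair i ` {k \<in> {1..l}. S (i, k) \<in> B}"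
      by (auto simp: J_def)
    then show ?thesis
      by (simp add: card_image inj_on_def)
  qed
  then have "{S. l \<le> 2 * card {k \<in> {1..l}. S (i, k) \<in> B}} =
      {S :: nat \<times> nat \<Rightarrow> 'f mat \<times> 'f Matrix.vec.
        real (card J) / 2 \<le> real (card {j \<in> J. S j \<in> B})}"
    by (auto simp: cardJ)
  moreover have "measure_pmf.prob (wish_samples n q r \<delta>)
      {S :: nat \<times> nat \<Rightarrow> 'f mat \<times> 'f Matrix.vec.
        real (card J) / 2 \<le> real (card {j \<in> J. S j \<in> B})}
    \<le> exp (- (2 * (1 / 2 - \<rho>)\<^sup>2 * real (card J)))"
    unfolding wish_samples_def
    by (rule prob_Pi_pmf_half_of_rare_le)
       (use assms in \<open>auto simp: J_def wish_queries_def l_def\<close>)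
  ultimately show ?thesis
    by (simp add: cardJ flip: l_def)
qed

section \<open>Accuracy of the estimate\<close>

text \<open>\<open>n! \<le> q ^ n\<close>, and the number of levels is chosen so that the grid
  reaches \<open>q ^ n\<close>.\<close>

lemma card_permutes_le_power_levels:
  assumes "n < q" "wish_r q > 0"
  shows "real (card {\<sigma>. \<sigma> permutes {0..<n}}) \<le>
    (real q / real (wish_r q)) ^ wish_levels n q (wish_r q)"
proof -
  define Q where "Q = real q / real (wish_r q)"
  have Q: "Q > 2"
    using wish_ratio_bounds[OF assms(2)] by (simp add: Q_def)
  have "card {\<sigma>. \<sigma> permutes {0..<n}} = fact n"
    by (rule card_permutations) auto
  then have "real (card {\<sigma>. \<sigma> permutes {0..<n}}) = fact n"
    by simp
  also have "\<dots> \<le> real n ^ n"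
    using fact_le_power[of n, where 'a = real] by simp
  also have "\<dots> \<le> real q ^ n"
    using assms by (intro power_mono) auto
  also have "\<dots> = Q powr (real n * log Q (real q))"
  proof -
    have "Q powr (real n * log Q (real q)) = (Q powr log Q (real q)) powr real n"
      by (simp add: powr_powr mult.commute)
    then show ?thesis
      using assms Q by (simp add: powr_realpow)
  qed
  also have "\<dots> \<le> Q powr real (wish_levels n q (wish_r q))"
    using Q unfolding wish_levels_def Q_def[symmetric]
    by (intro powr_mono) (auto simp: real_nat_ceiling_ge)
  also have "\<dots> = Q ^ wish_levels n q (wish_r q)"
    using Q by (simp add: powr_realpow)
  finally show ?thesis
    by (simp add: Q_def)
qed

lemma wish_median_ge:
  assumes "2 * card {k \<in> {1..wish_reps (dim_row D) q r \<delta>}.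
      max_oracle \<alpha> r D (fst (S (i, k))) (snd (S (i, k))) < v} < wish_reps (dim_row D) q r \<delta>"
  shows "v \<le> wish_median \<alpha> D q r \<delta> S i"
  unfolding wish_median_def using assms
  by (intro median_ge) (simp add: filter_map distinct_length_filter o_def Int_def conj_commute
      atLeastLessThanSuc_atLeastAtMost del: upt_Suc)

lemma wish_median_le:
  assumes "2 * card {k \<in> {1..wish_reps (dim_row D) q r \<delta>}.
      v < max_oracle \<alpha> r D (fst (S (i, k))) (snd (S (i, k)))} < wish_reps (dim_row D) q r \<delta>"
  shows "wish_median \<alpha> D q r \<delta> S i \<le> v"
  unfolding wish_median_def using assms
  by (intro median_le) (simp add: filter_map distinct_length_filter o_def Int_def conj_commute
      atLeastLessThanSuc_atLeastAtMost del: upt_Suc)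

text \<open>The strict inequalities in the median lemmas need a repetition even when no value is
  bad.\<close>

lemma wish_reps_pos:
  assumes "wish_r q > 0" "n \<ge> 1" "0 < \<delta>" "\<delta> < 1"
  shows "wish_reps n q (wish_r q) \<delta> > 0"
proof -
  have "2 * real n / \<delta> > 1"
    using assms by (simp add: field_simps)
  then have "ln (2 * real n / \<delta>) > 0"
    by simp
  then have "1 / wish_gamma q (wish_r q) * ln (2 * real n / \<delta>) > 0"
    using wish_gamma_bounds[OF assms(1)] by (intro mult_pos_pos) auto
  then show ?thesis
    unfolding wish_reps_def by simp
qed

lemma perm_wish_approximation:
  fixes n q r :: nat and D :: "real mat" and \<alpha> :: "nat \<Rightarrow> 'f::{field,finite}" and \<delta> :: real
  assumes n: "n \<ge> 1" and D: "D \<in> carrier_mat n n"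
    and D_nonneg: "\<And>i j. i < n \<Longrightarrow> j < n \<Longrightarrow> D $$ (i, j) \<ge> 0"
    and "q > n" and q: "CARD('f) = q" and \<alpha>: "bij_betw \<alpha> {0..<q} UNIV"
    and r_def: "r = wish_r q" and "r > 0" and "\<delta> > 0"
  shows "1 - \<delta> \<le> measure_pmf.prob (perm_wish \<alpha> D q r \<delta>)
           {Z. permanent D / (real q / real r)\<^sup>2 \<le> Z \<and>
               Z \<le> (real q / real r)\<^sup>2 * permanent D}"
proof (cases "\<delta> < 1")
  case False
  then show ?thesis
    by (smt (verit) measure_nonneg)
next
  case True
  define P where "P = {\<sigma>. \<sigma> permutes {0..<n}}"
  define N where "N = card P"
  define Q where "Q = real q / real r"
  define L where "L = wish_levels n q r"
  define l where "l = wish_reps n q r \<delta>"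
  define \<rho> where "\<rho> = 1 / (1 + Q)"
  define val where "val x = max_oracle \<alpha> r D (fst x) (snd x)" for x :: "'f mat \<times> 'f Matrix.vec"
  define M where "M = wish_median \<alpha> D q r \<delta>"
  have r: "wish_r q > 0"
    using \<open>r > 0\<close> r_def by simp
  have rq: "r < CARD('f)"
    using \<open>r > 0\<close> by (simp add: q r_def wish_r_def)
  have nq: "n < CARD('f)"
    using \<open>q > n\<close> q by simp
  have \<alpha>': "bij_betw \<alpha> {0..<CARD('f)} UNIV"
    using \<alpha> q by simp
  note ctxt = n D D_nonneg nq \<alpha>' rq
  have dimD: "dim_row D = n"
    using D by simp
  have Q: "Q > 2"
    using wish_ratio_bounds[OF r] by (simp add: Q_def r_def)
  have rQ: "real r / real CARD('f) = 1 / Q"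
    using \<open>r > 0\<close> by (simp add: Q_def q)
  have \<rho>: "\<rho> \<le> 1 / 2"
    using Q by (simp add: \<rho>_def field_simps)
  have l: "l > 0"
    using wish_reps_pos[OF r n \<open>\<delta> > 0\<close> True] by (simp add: l_def r_def)
  have finP: "finite P"
    by (simp add: P_def finite_permutations)
  have "id \<in> P"
    by (simp add: P_def permutes_id)
  then have N: "N \<ge> 1"
    using finP by (auto simp: N_def Suc_le_eq card_gt_0_iff)
  obtain e where e: "bij_betw e {..<N} P"
    and e_anti: "\<And>i j. i \<le> j \<Longrightarrow> j < N \<Longrightarrow> perm_weight D (e j) \<le> perm_weight D (e i)"
    using obtain_decreasing_enumeration[OF finP, of "perm_weight D"] unfolding N_def by blast
  define s where "s k = (if k < N then perm_weight D (e k) else 0)" for k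
  have eP: "e k \<in> P" if "k < N" for k
    using e that by (auto simp: bij_betw_def)
  have w_nonneg: "perm_weight D \<sigma> \<ge> 0" if "\<sigma> \<in> P" for \<sigma>
    using perm_weight_nonneg[OF ctxt] that by (simp add: P_def)
  have anti: "antimono s"
    using e_anti w_nonneg eP by (auto simp: antimono_def s_def)
  have s_zero: "s k = 0" if "k \<ge> N" for k
    using that by (simp add: s_def)
  have s_nonneg: "s k \<ge> 0" for k
    using w_nonneg eP by (simp add: s_def)
  have perm: "permanent D = (\<Sum>k<N. s k)"
  proof -
    have "permanent D = (\<Sum>\<sigma>\<in>P. perm_weight D \<sigma>)"
      by (simp add: permanent_def dimD P_def)
    also have "\<dots> = (\<Sum>k<N. perm_weight D (e k))"
      by (rule sum.reindex_bij_betw[OF e, symmetric])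
    finally show ?thesis
      by (simp add: s_def)
  qed
  have Max_s: "Max (perm_weight D ` P) = s 0"
  proof (rule Max_eqI)
    show "w \<le> s 0" if "w \<in> perm_weight D ` P" for w
    proof -
      obtain k where "k < N" "w = perm_weight D (e k)"
        using \<open>w \<in> perm_weight D ` P\<close> e by (auto simp: bij_betw_def)
      then show ?thesis
        using e_anti[of 0 k] by (simp add: s_def)
    qed
    show "s 0 \<in> perm_weight D ` P"
      using eP[of 0] N by (simp add: s_def)
  qed (use finP in auto)
  have val_bounds: "0 \<le> val x" "val x \<le> s 0" for x
    using max_oracle_bounds[OF ctxt] by (auto simp: val_def Max_s simp flip: P_def)

  \<comment> \<open>Bad oracle values at a single level\<close>
  define Up where "Up i = {x. s (nat \<lfloor>Q ^ (i - 1) / Q\<rfloor>) < val x}" for i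
  define Lo where "Lo i = {x. val x < s (nat \<lfloor>Q ^ (i + 1)\<rfloor>)}" for i
  have prob_Up: "measure_pmf.prob (pair_pmf (uniform_mat i n) (uniform_vec i)) (Up i) \<le> \<rho>"
    if "i \<ge> 1" for i
  proof -
    define t where "t = nat \<lfloor>Q ^ (i - 1) / Q\<rfloor>"
    \<comment> \<open>The heaviest \<open>t\<close> permutations, or all of them if \<open>t\<close>
      exceeds \<open>N\<close>; every other one has weight at most \<open>s t\<close>.\<close>
    define T where "T = e ` {..<min t N}"
    have "measure_pmf.prob (pair_pmf (uniform_mat i n) (uniform_vec i)) (Up i) \<le>
        real (card T) * (real r / real CARD('f)) ^ i"
      unfolding Up_def val_def t_def[symmetric]
    proof (rule prob_max_oracle_gt[OF ctxt])
      show "T \<subseteq> {\<sigma>. \<sigma> permutes {0..<n}}"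
        using eP by (auto simp: T_def simp flip: P_def)
      fix \<sigma> assume "\<sigma> permutes {0..<n}" "\<sigma> \<notin> T"
      then obtain k where "k < N" "\<sigma> = e k" "k \<ge> t"
        using e by (force simp: T_def P_def bij_betw_def)
      then show "perm_weight D \<sigma> \<le> s t"
        using antimonoD[OF anti, of t k] by (simp add: s_def split: if_splits)
    qed (use s_nonneg in auto)
    also have "\<dots> = real (card T) / Q ^ i"
      by (simp add: rQ power_divide)
    also have "\<dots> \<le> (Q ^ (i - 1) / Q) / Q ^ i"
    proof (intro divide_right_mono)
      have "card T \<le> t"
        unfolding T_def using card_image_le[of "{..<min t N}" e] by simp
      then have "real (card T) \<le> real t"
        by simp
      also have "real t \<le> Q ^ (i - 1) / Q"
        using Q by (simp add: t_def)
      finally show "real (card T) \<le> Q ^ (i - 1) / Q" .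
    qed (use Q in auto)
    also have "\<dots> = 1 / (Q * Q)"
      using Q that by (cases i) auto
    \<comment> \<open>Since \<open>Q > 2\<close>,
      \<open>1 + Q \<le> 2 * Q \<le> Q * Q\<close>.\<close>
    also have "\<dots> \<le> \<rho>"
    proof -
      have "2 * Q \<le> Q * Q"
        using Q by simp
      then show ?thesis
        unfolding \<rho>_def using Q by (intro frac_le) linarith+
    qed
    finally show ?thesis .
  qed
  have prob_Lo: "measure_pmf.prob (pair_pmf (uniform_mat i n) (uniform_vec i)) (Lo i) \<le> \<rho>" for i
  proof (cases "nat \<lfloor>Q ^ (i + 1)\<rfloor> < N")
    case False
    then have "Lo i = {}"
      using val_bounds by (auto simp: Lo_def s_zero not_less)
    then show ?thesis
      using Q by (simp add: \<rho>_def)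
  next
    case True
    define t where "t = nat \<lfloor>Q ^ (i + 1)\<rfloor>"
    \<comment> \<open>Including index \<open>t\<close> gives \<open>t + 1\<close> permutations, at
      least \<open>Q ^ (i + 1)\<close> despite the floor, so at least \<open>Q\<close> survivors are
      expected.\<close>
    define T where "T = e ` {..t}"
    have "card T = t + 1"
      unfolding T_def using e True
      by (subst card_image) (auto simp: bij_betw_def t_def intro: inj_on_subset)
    then have "Q ^ (i + 1) \<le> real (card T)"
      unfolding t_def by linarith
    then have "Q ^ (i + 1) * (1 / Q ^ i) \<le> real (card T) * (1 / Q ^ i)"
      using Q by (intro mult_right_mono) auto
    then have card_T: "Q \<le> real (card T) * (real r / real CARD('f)) ^ i"
      using Q by (simp add: rQ power_divide)
    have "measure_pmf.prob (pair_pmf (uniform_mat i n) (uniform_vec i)) (Lo i) \<le>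
        1 / (1 + real (card T) * (real r / real CARD('f)) ^ i)"
      unfolding Lo_def val_def t_def[symmetric]
    proof (rule prob_max_oracle_lt[OF ctxt])
      show "T \<subseteq> {\<sigma>. \<sigma> permutes {0..<n}}"
        using eP True by (auto simp: T_def t_def simp flip: P_def)
      show "s t \<le> perm_weight D \<sigma>" if "\<sigma> \<in> T" for \<sigma>
        using that True e_anti[of _ t] by (auto simp: T_def s_def t_def)
    qed
    also have "\<dots> \<le> \<rho>"
      unfolding \<rho>_def using card_T Q by (intro frac_le) auto
    finally show ?thesis .
  qed

  \<comment> \<open>Union bound over the levels\<close>
  define Maj where "Maj B i = {S :: nat \<times> nat \<Rightarrow> 'f mat \<times> 'f Matrix.vec.
      l \<le> 2 * card {k \<in> {1..l}. S (i, k) \<in> B}}" for B i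
  define E where "E = exp (- (2 * (1 / 2 - \<rho>)\<^sup>2 * real l))"
  define \<Omega> where "\<Omega> = (wish_samples n q r \<delta> :: (nat \<times> nat \<Rightarrow> 'f mat \<times> 'f Matrix.vec) pmf)"
  have prob_Maj: "measure_pmf.prob \<Omega> (Maj B i) \<le> E"
    if "i \<in> {1..L}" "measure_pmf.prob (pair_pmf (uniform_mat i n) (uniform_vec i)) B \<le> \<rho>" for B i
    using prob_wish_samples_half_of_rare_le[OF _ \<rho> that(2), of q r \<delta>] that(1)
    by (simp add: Maj_def E_def \<Omega>_def l_def L_def)
  \<comment> \<open>\<open>Up\<close> at level 1 and \<open>Lo\<close> at level \<open>L\<close> are
    left out, since the corresponding median bounds always hold; this leaves
    \<open>2 * (L - 1)\<close> events.\<close>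
  define Bad where "Bad = (\<Union>i\<in>{2..L}. Maj (Up i) i) \<union> (\<Union>i\<in>{1..L-1}. Maj (Lo i) i)"
  have "measure_pmf.prob \<Omega> Bad \<le> measure_pmf.prob \<Omega> (\<Union>i\<in>{2..L}. Maj (Up i) i) +
      measure_pmf.prob \<Omega> (\<Union>i\<in>{1..L-1}. Maj (Lo i) i)"
    unfolding Bad_def by (intro measure_Un_le) auto
  also have "\<dots> \<le> (\<Sum>i\<in>{2..L}. measure_pmf.prob \<Omega> (Maj (Up i) i)) +
      (\<Sum>i\<in>{1..L-1}. measure_pmf.prob \<Omega> (Maj (Lo i) i))"
    by (intro add_mono measure_pmf.finite_measure_subadditive_finite) auto
  also have "\<dots> \<le> (\<Sum>i\<in>{2..L}. E) + (\<Sum>i\<in>{1..L-1}. E)"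
    using prob_Up prob_Lo by (intro add_mono sum_mono prob_Maj) auto
  also have "\<dots> = 2 * real (L - 1) * E"
    by simp
  also have "\<dots> \<le> \<delta>"
    using wish_failure_budget[OF n r \<open>\<delta> > 0\<close> True]
    by (simp add: L_def E_def \<rho>_def Q_def l_def r_def)
  finally have prob_Bad: "measure_pmf.prob \<Omega> Bad \<le> \<delta>" .

  \<comment> \<open>Accuracy outside the bad event\<close>
  have good: "permanent D / Q\<^sup>2 \<le> wish_estimate \<alpha> D q r \<delta> S"
    "wish_estimate \<alpha> D q r \<delta> S \<le> Q\<^sup>2 * permanent D" if "S \<notin> Bad" for S
  proof -
    have est: "wish_estimate \<alpha> D q r \<delta> S = s 0 + (Q - 1) * (\<Sum>i<L. M S (i + 1) * Q ^ i)"
      unfolding wish_estimate_def dimD P_def[symmetric] Max_s by (simp add: Q_def L_def M_def)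
    have M_le: "M S i \<le> v" if "2 * card {k \<in> {1..l}. v < val (S (i, k))} < l" for i v
      using wish_median_le[of D q r \<delta> v \<alpha> S i] that
      by (simp add: M_def val_def dimD l_def)
    have M_ge: "v \<le> M S i" if "2 * card {k \<in> {1..l}. val (S (i, k)) < v} < l" for i v
      using wish_median_ge[of D q r \<delta> \<alpha> S i v] that
      by (simp add: M_def val_def dimD l_def)
    have le: "M S (i + 1) \<le> s (nat \<lfloor>Q ^ i / Q\<rfloor>)" if "i < L" for i
    proof (cases "i = 0")
      case True
      \<comment> \<open>At the first level the bound is \<open>s 0\<close>, the largest weight,
        which no oracle value exceeds.\<close>
      have "\<lfloor>1 / Q\<rfloor> = 0"
        using Q by (simp add: floor_eq_iff)
      moreover have "M S (i + 1) \<le> s 0"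
        using l val_bounds by (intro M_le) (auto simp: not_less[symmetric])
      ultimately show ?thesis
        using True by simp
    next
      case False
      then have "S \<notin> Maj (Up (i + 1)) (i + 1)"
        using \<open>S \<notin> Bad\<close> that by (auto simp: Bad_def)
      then show ?thesis
        by (intro M_le) (simp add: Maj_def Up_def)
    qed
    have ge: "s (nat \<lfloor>Q ^ (i + 2)\<rfloor>) \<le> M S (i + 1)" if "i < L" for i
    proof (cases "i + 1 < L")
      case True
      then have "S \<notin> Maj (Lo (i + 1)) (i + 1)"
        using \<open>S \<notin> Bad\<close> by (auto simp: Bad_def)
      then show ?thesis
        by (intro M_ge) (simp add: Maj_def Lo_def)
    next
      case False
      \<comment> \<open>At the last level the index is past all \<open>N\<close> weights, so the
        lower bound is 0.\<close>
      have "real N \<le> Q ^ L"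
        using card_permutes_le_power_levels[OF \<open>q > n\<close> r]
        by (simp add: N_def P_def Q_def L_def r_def)
      also have "\<dots> \<le> Q ^ (i + 2)"
        using False Q by (intro power_increasing) auto
      finally have "s (nat \<lfloor>Q ^ (i + 2)\<rfloor>) = 0"
        by (intro s_zero) (simp add: le_nat_floor)
      moreover have "0 \<le> M S (i + 1)"
        using l val_bounds by (intro M_ge) (auto simp: not_less[symmetric])
      ultimately show ?thesis
        by simp
    qed
    have "real N \<le> Q ^ L"
      using card_permutes_le_power_levels[OF \<open>q > n\<close> r]
      by (simp add: N_def P_def Q_def L_def r_def)
    also have "\<dots> \<le> Q ^ (L + 2)"
      using Q by (intro power_increasing) auto
    finally have "permanent D \<le> Q\<^sup>2 * wish_estimate \<alpha> D q r \<delta> S"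
      unfolding est perm using Q ge
      by (intro geometric_quadrature_ge anti s_zero) auto
    then show "permanent D / Q\<^sup>2 \<le> wish_estimate \<alpha> D q r \<delta> S"
      using Q by (simp add: divide_le_eq mult.commute)
    show "wish_estimate \<alpha> D q r \<delta> S \<le> Q\<^sup>2 * permanent D"
      unfolding est perm using Q N le
      by (intro geometric_quadrature_le anti s_zero) auto
  qed

  have "1 - \<delta> \<le> 1 - measure_pmf.prob \<Omega> Bad"
    using prob_Bad by simp
  also have "\<dots> = measure_pmf.prob \<Omega> (- Bad)"
    using measure_pmf.prob_compl[of Bad \<Omega>] by (simp add: Compl_eq_Diff_UNIV)
  also have "\<dots> \<le> measure_pmf.prob \<Omega> (wish_estimate \<alpha> D q r \<delta> -`
      {Z. permanent D / Q\<^sup>2 \<le> Z \<and> Z \<le> Q\<^sup>2 * permanent D})"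
    using good by (intro measure_pmf.finite_measure_mono) auto
  finally show ?thesis
    by (simp add: perm_wish_def dimD Q_def \<Omega>_def)
qed

text \<open>The \<open>principal\<close> filters make the Landau bounds hold at every parameter of
  the set with one constant. \<open>c > 1\<close> keeps \<open>ln (m / \<epsilon>)\<close> away from
  0, since the call count stays positive as that logarithm vanishes. The count is given for fixed
  \<open>q\<close>, where constants absorb the factor depending on \<open>q\<close>, and uniformly
  in \<open>p\<close>, where this factor is explicit.\<close>

theorem theorem2:
  fixes n q r :: nat and D :: "real mat" and \<alpha> :: "nat \<Rightarrow> 'f::{field,finite}" and \<delta> :: real
  assumes "n \<ge> 1"
    and "D \<in> carrier_mat n n"
    and "\<And>i j. i < n \<Longrightarrow> j < n \<Longrightarrow> D $$ (i, j) \<ge> 0"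
    and "primepow q" and "q > n"
    and "CARD('f) = q" and "bij_betw \<alpha> {0..<q} UNIV"
    and "r = wish_r q" and "r > 0"
    and "\<delta> > 0"
  shows "measure_pmf.prob (perm_wish \<alpha> D q r \<delta>)
           {Z. permanent D / (real q / real r)\<^sup>2 \<le> Z \<and>
               Z \<le> (real q / real r)\<^sup>2 * permanent D} \<ge> 1 - \<delta>
    \<and> (\<lambda>(m, p). (real p / real (wish_r p))\<^sup>2 - 4)
        \<in> O[principal {(m, p). 1 \<le> m \<and> m < p \<and> primepow p \<and> wish_r p > 0}](
           \<lambda>(m, p). 1 / real m)
    \<and> (\<forall>c>1. (\<lambda>(m, \<epsilon>). real (wish_calls m q r \<epsilon>))
        \<in> \<Theta>[principal {(m, \<epsilon>). 1 \<le> m \<and> m < q \<and> 0 < \<epsilon> \<and> c \<le> real m / \<epsilon>}](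
           \<lambda>(m, \<epsilon>). real m * ln (real m / \<epsilon>)))
    \<and> (\<forall>c>1. (\<lambda>(m, p, \<epsilon>). real (wish_calls m p (wish_r p) \<epsilon>))
        \<in> \<Theta>[principal {(m, p, \<epsilon>). 1 \<le> m \<and> m < p \<and> primepow p \<and> wish_r p > 0 \<and>
               0 < \<epsilon> \<and> c \<le> real m / \<epsilon>}](
           \<lambda>(m, p, \<epsilon>). log (real p / real (wish_r p)) (real p) / wish_gamma p (wish_r p) *
              (real m * ln (real m / \<epsilon>))))"
proof (intro conjI allI impI)
  show "measure_pmf.prob (perm_wish \<alpha> D q r \<delta>)
           {Z. permanent D / (real q / real r)\<^sup>2 \<le> Z \<and>
               Z \<le> (real q / real r)\<^sup>2 * permanent D} \<ge> 1 - \<delta>"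
    by (rule perm_wish_approximation) (use assms in auto)
  show "(\<lambda>(m, p). (real p / real (wish_r p))\<^sup>2 - 4)
        \<in> O[principal {(m, p). 1 \<le> m \<and> m < p \<and> primepow p \<and> wish_r p > 0}](
           \<lambda>(m, p). 1 / real m)"
    by (rule bigoI[where c = 48])
       (use wish_ratio_square_diff_le in \<open>force simp: eventually_principal\<close>)
next
  fix c :: real
  assume c: "c > 1"
  define C where "C = 4 * (1 + ln 2 / ln c)"
  define K where "K = log (real q / real r) (real q) / wish_gamma q r"
  have r: "wish_r q > 0"
    using assms by simp
  have "0 < log (real q / real r) (real q)" "0 < wish_gamma q r"
    using log_ratio_bounds[OF r] wish_gamma_bounds[OF r] assms by auto
  then have K: "K > 0"
    by (simp add: K_def)
  have C: "C > 0"
    using c by (simp add: C_def add_pos_nonneg)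
  have "K * norm (real m * ln (real m / \<epsilon>)) \<le> norm (real (wish_calls m q r \<epsilon>)) \<and>
      norm (real (wish_calls m q r \<epsilon>)) \<le> C * K * norm (real m * ln (real m / \<epsilon>))"
    if "1 \<le> m" "0 < \<epsilon>" "c \<le> real m / \<epsilon>" for m \<epsilon>
  proof -
    define v where "v = real m * ln (real m / \<epsilon>)"
    have "ln (real m / \<epsilon>) \<ge> 0"
      using that c by (intro ln_ge_zero) linarith
    then have "v \<ge> 0"
      by (simp add: v_def)
    moreover have "K * v \<le> real (wish_calls m q r \<epsilon>)" "real (wish_calls m q r \<epsilon>) \<le> C * (K * v)"
      using wish_calls_bounds[OF r that(1,2) c that(3)] assms by (simp_all add: K_def C_def v_def)
    ultimately show ?thesis
      unfolding v_def[symmetric] by (simp add: mult.assoc)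
  qed
  then show "(\<lambda>(m, \<epsilon>). real (wish_calls m q r \<epsilon>))
        \<in> \<Theta>[principal {(m, \<epsilon>). 1 \<le> m \<and> m < q \<and> 0 < \<epsilon> \<and> c \<le> real m / \<epsilon>}](
           \<lambda>(m, \<epsilon>). real m * ln (real m / \<epsilon>))"
    using C K by (intro bigthetaI'[of K "C * K"]) (auto simp: eventually_principal)
next
  fix c :: real
  assume c: "c > 1"
  define C where "C = 4 * (1 + ln 2 / ln c)"
  define K where "K m p \<epsilon> = log (real p / real (wish_r p)) (real p) / wish_gamma p (wish_r p) *
              (real m * ln (real m / \<epsilon>))" for m p and \<epsilon> :: real
  have C: "C > 0"
    using c by (simp add: C_def add_pos_nonneg)
  \<comment> \<open>Here \<open>K\<close> carries the dependence on \<open>p\<close>, so the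
    constants 1 and \<open>C\<close> depend on \<open>c\<close> alone.\<close>
  have "1 * norm (K m p \<epsilon>) \<le> norm (real (wish_calls m p (wish_r p) \<epsilon>)) \<and>
      norm (real (wish_calls m p (wish_r p) \<epsilon>)) \<le> C * norm (K m p \<epsilon>)"
    if "1 \<le> m" "wish_r p > 0" "0 < \<epsilon>" "c \<le> real m / \<epsilon>" for m p \<epsilon>
    using wish_calls_bounds[OF that(2,1,3) c that(4)]
    unfolding K_def[symmetric] C_def[symmetric] by simp
  then show "(\<lambda>(m, p, \<epsilon>). real (wish_calls m p (wish_r p) \<epsilon>))
        \<in> \<Theta>[principal {(m, p, \<epsilon>). 1 \<le> m \<and> m < p \<and> primepow p \<and> wish_r p > 0 \<and>
               0 < \<epsilon> \<and> c \<le> real m / \<epsilon>}](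
           \<lambda>(m, p, \<epsilon>). log (real p / real (wish_r p)) (real p) / wish_gamma p (wish_r p) *
              (real m * ln (real m / \<epsilon>)))"
    unfolding K_def[symmetric] using C
    by (intro bigthetaI'[of 1 C]) (auto simp: eventually_principal)
qed

end
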